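(* Let $0<\lambda\le\Lambda$. There exist constants $0<\nu<1$ and $M>1$, depending only on $\lambda,\Lambda$, such that the following holds for every operator $L=a_{11}X_1^2+2a_{12}X_2X_1+a_{22}X_2^2$ with ellipticity constants $\lambda,\Lambda$, every $y=(y_1,y_2)\in\mathbb{R}^2$ and every $r>0$: if $u\in C^2(G(y,2r))\cap C(\overline{G(y,2r)})$ is nonnegative, satisfies $Lu\le 0$ in $G(y,2r)$, and $\inf_{G(y,r)}u\le 1$, then $$\left|\{u\le M\}\cap G(y,3r/2)\right|\ge\nu\,|G(y,3r/2)|,$$ where $|\cdot|$ is Lebesgue measure.
   Context: On $\mathbb{R}^2$ with points $x=(x_1,x_2)$, let $X_1=\partial_{x_1}$ and $X_2=x_1\partial_{x_2}$ (Grushin vector fields). The operator is $L=a_{11}X_1^2+2a_{12}X_2X_1+a_{22}X_2^2$, i.e. $Lu=a_{11}u_{x_1x_1}+2a_{12}X_2X_1u+a_{22}X_2^2u$ with $X_2X_1u=x_1u_{x_1x_2}$ and $X_2^2u=x_1^2u_{x_2x_2}$, where $a_{11},a_{12},a_{22}$ are measurable real functions on $\mathbb{R}^2$ such that at every point $\lambda(\xi_1^2+\xi_2^2)\le a_{11}\xi_1^2+2a_{12}\xi_1\xi_2+a_{22}\xi_2^2\le\Lambda(\xi_1^2+\xi_2^2)$ for all $\xi\in\mathbb{R}^2$; then $\lambda,\Lambda$ are called ellipticity constants of $L$. Let $\rho(x,y)=\left((x_1^2-y_1^2)^2+4(x_2-y_2)^2\right)^{1/4}$. For $r>0$ define $g_r(x,y)=\rho(x,y)$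 if $|y_1|<r$; $g_r(x,y)=\rho^2(x,y)/|y_1|$ if $|y_1|\ge r$ and $x_1y_1\ge 0$; $g_r(x,y)=+\infty$ if $|y_1|\ge r$ and $x_1y_1<0$. Set $G(y,r)=\{x\in\mathbb{R}^2:g_r(x,y)<r\}$. *)

theory Defs
  imports "HOL-Analysis.Analysis"
begin

definition partial_deriv :: "(real^'n \<Rightarrow> real) \<Rightarrow> 'n \<Rightarrow> real^'n \<Rightarrow> real" where
  "partial_deriv f i x = deriv (\<lambda>t. f (x + t *\<^sub>R axis i 1)) 0"

text \<open>The class $C^k(S)$, for open S: all partial derivatives up to order k exist
  and are continuous on S.\<close>

primrec Ck_on :: "nat \<Rightarrow> (real^'n \<Rightarrow> real) \<Rightarrow> (real^'n) set \<Rightarrow> bool" where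
  "Ck_on 0 f S \<longleftrightarrow> continuous_on S f"
| "Ck_on (Suc k) f S \<longleftrightarrow> continuous_on S f \<and>
     (\<forall>i. (\<forall>x\<in>S. (\<lambda>t. f (x + t *\<^sub>R axis i 1)) differentiable (at 0)) \<and>
          Ck_on k (partial_deriv f i) S)"

definition X1 :: "(real^2 \<Rightarrow> real) \<Rightarrow> real^2 \<Rightarrow> real" where
  "X1 f x = partial_deriv f 1 x"

definition X2 :: "(real^2 \<Rightarrow> real) \<Rightarrow> real^2 \<Rightarrow> real" where
  "X2 f x = x$1 * partial_deriv f 2 x"

definition grushin_op ::
  "(real^2 \<Rightarrow> real) \<Rightarrow> (real^2 \<Rightarrow> real) \<Rightarrow> (real^2 \<Rightarrow> real) \<Rightarrow> (real^2 \<Rightarrow> real) \<Rightarrow> real^2 \<Rightarrow> real" where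
  "grushin_op a11 a12 a22 u x =
     a11 x * X1 (X1 u) x + 2 * a12 x * X2 (X1 u) x + a22 x * X2 (X2 u) x"

lemma grushin_op_eq:
  assumes "Ck_on 2 u S" "x \<in> S"
  shows "grushin_op a11 a12 a22 u x =
     a11 x * partial_deriv (partial_deriv u 1) 1 x
     + 2 * a12 x * (x$1 * partial_deriv (partial_deriv u 1) 2 x)
     + a22 x * ((x$1)\<^sup>2 * partial_deriv (partial_deriv u 2) 2 x)"
proof -
  have "(\<lambda>t. partial_deriv u 2 (x + t *\<^sub>R axis 2 1)) differentiable (at 0)"
    using assms by (simp add: numeral_2_eq_2)
  then have "partial_deriv (X2 u) 2 x = x$1 * partial_deriv (partial_deriv u 2) 2 x"
    by (simp add: partial_deriv_def[of "X2 u"] partial_deriv_def[of "partial_deriv u 2"] X2_def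
        axis_def deriv_cmult field_differentiable_def real_differentiable_def)
  then show ?thesis
    by (simp add: grushin_op_def X1_def[abs_def] X2_def[of "X2 u"] X2_def[of "partial_deriv u 1"]
        power2_eq_square)
qed

definition ellipticity_constants ::
  "real \<Rightarrow> real \<Rightarrow> (real^2 \<Rightarrow> real) \<Rightarrow> (real^2 \<Rightarrow> real) \<Rightarrow> (real^2 \<Rightarrow> real) \<Rightarrow> bool" where
  "ellipticity_constants lam Lam a11 a12 a22 \<longleftrightarrow>
     (\<forall>x. \<forall>\<xi>::real^2.
        lam * ((\<xi>$1)\<^sup>2 + (\<xi>$2)\<^sup>2)
          \<le> a11 x * (\<xi>$1)\<^sup>2 + 2 * a12 x * \<xi>$1 * \<xi>$2 + a22 x * (\<xi>$2)\<^sup>2 \<and>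
        a11 x * (\<xi>$1)\<^sup>2 + 2 * a12 x * \<xi>$1 * \<xi>$2 + a22 x * (\<xi>$2)\<^sup>2
          \<le> Lam * ((\<xi>$1)\<^sup>2 + (\<xi>$2)\<^sup>2))"

definition rho :: "real^2 \<Rightarrow> real^2 \<Rightarrow> real" where
  "rho x y = root 4 (((x$1)\<^sup>2 - (y$1)\<^sup>2)\<^sup>2 + 4 * (x$2 - y$2)\<^sup>2)"

definition g :: "real \<Rightarrow> real^2 \<Rightarrow> real^2 \<Rightarrow> ereal" where
  "g r x y =
     (if \<bar>y$1\<bar> < r then ereal (rho x y)
      else if x$1 * y$1 \<ge> 0 then ereal ((rho x y)\<^sup>2 / \<bar>y$1\<bar>)
      else \<infinity>)"

definition G :: "real^2 \<Rightarrow> real \<Rightarrow> (real^2) set" where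
  "G y r = {x. g r x y < ereal r}"

end

theory Submission
  imports Defs
begin

text \<open>For each y and r there is a family of concentric ellipses Q \<le> s, centred away from the
  axis x1 = 0, with \<open>G y r \<subseteq> {Q \<le> 9/10}\<close>, \<open>{Q \<le> 1} \<subseteq> G y (2 * r)\<close>
  and a small core \<open>{Q < 1/2000} \<subseteq> G y (3 * r / 2)\<close> of comparable area. The barrier
  K (exp (- p Q) - exp (- p)) vanishes on Q = 1, is at least 2 on Q \<le> 9/10 and, for p large, is a strict
  subsolution of every admissible L outside the core. If u is a supersolution with a value at most 3/2
  in G y r, then u minus the barrier minus any small affine function has an interior minimum, and since L
  annihilates affine functions this minimum lies in the core. There the degenerate coefficient x1 is bounded
  below, so L u \<le> 0 bounds the Jacobian of the gradient map at contact points, and the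
  contact set, on which u is at most M, has measure comparable to that of the core.\<close>

section \<open>Calculus in the plane\<close>

text \<open>The obstacle is the axis: at a contact point the inequality for L bounds only W11 + x1^2
  W22, where W is u minus the barrier, so W22 is out of control near x1 = 0, although the quasi-ball
  may be centred there. The horizontal gradient of Q is 2 (\<alpha> (x1 - c1), x1 \<beta> (x2 -
  c2)). For c1 = 0 it would vanish on the whole axis; for c1 \<noteq> 0 it vanishes only at the
  centre, so a large p can exclude contact outside a core that stays off the axis. Since the ellipse
  only has to fit between \<open>G y r\<close> and \<open>G y (2 * r)\<close>, there is room for
  such a shift. Slopes are measured in units of sqrt \<alpha> and sqrt \<beta>. Then the slopes fill
  an area of order sqrt (\<alpha> \<beta>), the Jacobian is of order \<alpha> \<beta>, and the
  contact set has measure of order 1 / sqrt (\<alpha> \<beta>), like the ellipse itself. This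
  balance makes the constants independent of y and r.\<close>

lemma has_derivative_vec_nth [derivative_intros]:
  fixes f :: "'a::real_normed_vector \<Rightarrow> real^'n"
  assumes "(f has_derivative f') F"
  shows "((\<lambda>x. f x $ i) has_derivative (\<lambda>x. f' x $ i)) F"
  using assms by (rule bounded_linear.has_derivative[OF bounded_linear_vec_nth])

text \<open>Continuity of one partial is enough: \<open>has_derivative_partialsI\<close> asks for
  the first partial only at the point and for the second nearby, continuous at the point. That rule
  lives on products, so \<open>f\<close> is carried to pairs through \<open>vector [a, b]\<close>
  and back.\<close>

lemma has_derivative_of_partials:
  fixes f :: "real^2 \<Rightarrow> real"
  assumes "open S" "x \<in> S"
    and d1: "\<And>z. z \<in> S \<Longrightarrow> ((\<lambda>t. f (z + t *\<^sub>R axis 1 1)) has_real_derivative f1 z) (at 0)"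
    and d2: "\<And>z. z \<in> S \<Longrightarrow> ((\<lambda>t. f (z + t *\<^sub>R axis 2 1)) has_real_derivative f2 z) (at 0)"
    and cont: "continuous_on S f2"
  shows "(f has_derivative (\<lambda>v. f1 x * v$1 + f2 x * v$2)) (at x)"
proof -
  obtain e where e: "e > 0" "ball x e \<subseteq> S"
    using \<open>open S\<close> \<open>x \<in> S\<close> openE by blast
  \<comment> \<open>Half-width e/2 on each axis: the norm is at most the sum of the coordinate
    distances, so the box lies in the ball.\<close>
  define X Y where "X = ball (x$1) (e/2)" and "Y = ball (x$2) (e/2)"
  have S: "vector [a, b] \<in> S" if "a \<in> X" "b \<in> Y" for a b
  proof -
    have "dist x (vector [a, b]) \<le> dist (x$1) a + dist (x$2) b"
      using norm_le_l1_cart[of "x - vector [a, b]"] by (simp add: sum_2 dist_norm)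
    then show ?thesis
      using that e by (auto simp: X_def Y_def)
  qed
  define F where "F = (\<lambda>a b. f (vector [a, b]))"
  have sh: "vector [a, b] + t *\<^sub>R axis 1 1 = (vector [t + a, b] :: real^2)"
    "vector [a, b] + t *\<^sub>R axis 2 1 = (vector [a, t + b] :: real^2)" for a b t :: real
    by (auto simp: vec_eq_iff forall_2 axis_def)
  have F1: "((\<lambda>a. F a b) has_real_derivative f1 (vector [a, b])) (at a)" if "a \<in> X" "b \<in> Y" for a b
    using d1[OF S[OF that]] DERIV_shift[of "\<lambda>a. F a b" _ 0 a] by (simp add: sh F_def)
  have F2: "(F a has_real_derivative f2 (vector [a, b])) (at b)" if "a \<in> X" "b \<in> Y" for a b
    using d2[OF S[OF that]] DERIV_shift[of "F a" _ 0 b] by (simp add: sh F_def)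
  have x: "x$1 \<in> X" "x$2 \<in> Y" "vector [x$1, x$2] = x"
    using e by (auto simp: X_def Y_def vec_eq_iff forall_2)
  have "isCont f2 x"
    using assms continuous_on_eq_continuous_at by blast
  moreover have "isCont (\<lambda>p::real\<times>real. (vector [fst p, snd p] :: real^2)) q" for q
    unfolding continuous_at
  proof (rule vec_tendstoI)
    show "((\<lambda>p. vector [fst p, snd p] $ i) \<longlongrightarrow> vector [fst q, snd q] $ i) (at q)" for i :: 2
      using exhaust_2[of i]
    proof
      assume i: "i = 1"
      show ?thesis unfolding i vector_2 by (intro tendsto_intros)
    next
      assume i: "i = 2"
      show ?thesis unfolding i vector_2 by (intro tendsto_intros)
    qed
  qed
  ultimately have "isCont (\<lambda>p. f2 (vector [fst p, snd p])) (x$1, x$2)"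
    using isCont_o2[where f="\<lambda>p::real\<times>real. (vector [fst p, snd p] :: real^2)" and g=f2 and a="(x$1, x$2)"]
    by (simp add: x)
  then have "continuous (at (x$1, x$2) within X \<times> Y) (\<lambda>p. f2 (vector [fst p, snd p]))"
    by (rule continuous_at_imp_continuous_at_within)
  then have "continuous (at (x$1, x$2) within X \<times> Y)
      (\<lambda>p. blinfun_mult_left (f2 (vector [fst p, snd p])))"
    by (rule bounded_linear.continuous[OF bounded_linear_blinfun_mult_left])
  then have "continuous (at (x$1, x$2) within X \<times> Y)
      (\<lambda>(a, b). blinfun_mult_left (f2 (vector [a, b])))"
    by (simp add: case_prod_unfold)
  then have "((\<lambda>(a, b). F a b) has_derivative
      (\<lambda>(s, t). f1 x * s + blinfun_mult_left (f2 (vector [x$1, x$2])) t)) (at (x$1, x$2) within X \<times> Y)"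
  proof (intro has_derivative_partialsI)
    show "((\<lambda>a. F a (x$2)) has_derivative (\<lambda>s. f1 x * s)) (at (x$1) within X)"
      using F1[OF x(1,2)] unfolding x(3) has_field_derivative_def by (rule has_derivative_at_withinI)
    show "(F a has_derivative blinfun_mult_left (f2 (vector [a, b]))) (at b within Y)"
      if "a \<in> X" "b \<in> Y" for a b
      using F2[OF that]
      unfolding blinfun_mult_left.rep_eq has_field_derivative_def mult.commute[of _ "f2 (vector [a, b])"]
      by (rule has_derivative_at_withinI)
  qed (use x in \<open>simp_all add: Y_def\<close>)
  then have "((\<lambda>p. F (fst p) (snd p)) has_derivative (\<lambda>p. f1 x * fst p + f2 x * snd p)) (at (x$1, x$2))"
    using x at_within_open[of "(x$1, x$2)" "X \<times> Y"]
    by (simp add: X_def Y_def open_Times case_prod_unfold mult.commute)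
  then have "((\<lambda>z. F (fst (z$1, z$2)) (snd (z$1, z$2))) has_derivative
      (\<lambda>v. f1 x * fst (v$1, v$2) + f2 x * snd (v$1, v$2))) (at x)"
    by (rule has_derivative_compose[rotated])
      (intro has_derivative_Pair has_derivative_vec_nth has_derivative_ident)
  moreover have "vector [z$1, z$2] = z" for z :: "real^2"
    by (auto simp: vec_eq_iff forall_2)
  ultimately show ?thesis
    by (simp add: F_def)
qed

lemma DERIV_along_line:
  fixes f :: "'a::real_normed_vector \<Rightarrow> real"
  assumes "(f has_derivative f') (at (x + t *\<^sub>R v))"
  shows "((\<lambda>t. f (x + t *\<^sub>R v)) has_real_derivative f' v) (at t)"
proof -
  have "((\<lambda>t. x + t *\<^sub>R v) has_derivative (\<lambda>s. s *\<^sub>R v)) (at t)"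
    by (auto intro!: derivative_eq_intros)
  then have "((\<lambda>t. f (x + t *\<^sub>R v)) has_derivative (\<lambda>s. f' (s *\<^sub>R v))) (at t)"
    using assms by (rule has_derivative_compose)
  then show ?thesis
    using has_derivative_bounded_linear[OF assms]
    by (simp add: has_field_derivative_def linear_simps mult.commute[of _ "f' v"])
qed

text \<open>Two nested mean value steps, in \<open>s\<close> for
  \<open>\<lambda>s. f s h - f s 0\<close> and then in \<open>t\<close> for \<open>f1 s\<close>. The
  second difference is symmetric in the two variables, so the same quantity can be expanded in
  either order.\<close>

lemma mixed_difference_mvt:
  fixes f :: "real \<Rightarrow> real \<Rightarrow> real"
  assumes "0 < h"
    and f1: "\<And>s t. 0 \<le> s \<Longrightarrow> s \<le> h \<Longrightarrow> 0 \<le> t \<Longrightarrow> t \<le> h \<Longrightarrow>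
      ((\<lambda>s. f s t) has_real_derivative f1 s t) (at s)"
    and f12: "\<And>s t. 0 \<le> s \<Longrightarrow> s \<le> h \<Longrightarrow> 0 \<le> t \<Longrightarrow> t \<le> h \<Longrightarrow>
      (f1 s has_real_derivative f12 s t) (at t)"
  obtains s t where "0 < s" "s < h" "0 < t" "t < h" "f h h - f h 0 - f 0 h + f 0 0 = h\<^sup>2 * f12 s t"
proof -
  have "\<exists>s. 0 < s \<and> s < h \<and> (f h h - f h 0) - (f 0 h - f 0 0) = (h - 0) * (f1 s h - f1 s 0)"
    using \<open>0 < h\<close> by (intro MVT2[where f="\<lambda>s. f s h - f s 0"]) (auto intro!: derivative_intros f1)
  then obtain s where s: "0 < s" "s < h" "f h h - f h 0 - f 0 h + f 0 0 = h * (f1 s h - f1 s 0)"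
    by (auto simp: algebra_simps)
  have "\<exists>t. 0 < t \<and> t < h \<and> f1 s h - f1 s 0 = (h - 0) * f12 s t"
    using \<open>0 < h\<close> s by (intro MVT2) (auto intro!: f12)
  then show ?thesis
    using s that by (auto simp: power2_eq_square)
qed

text \<open>If the mixed partials differed at \<open>x\<close>, continuity would keep their values
  apart on a small square; but the second difference over that square, divided by h^2, is a value of
  each of them.\<close>

lemma mixed_partials_commute:
  fixes u :: "real^2 \<Rightarrow> real"
  assumes "open S" "x \<in> S"
    and u: "\<And>z. z \<in> S \<Longrightarrow> (u has_derivative (\<lambda>v. u1 z * v$1 + u2 z * v$2)) (at z)"
    and u1: "\<And>z. z \<in> S \<Longrightarrow> (u1 has_derivative (\<lambda>v. u11 z * v$1 + u12 z * v$2)) (at z)"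
    and u2: "\<And>z. z \<in> S \<Longrightarrow> (u2 has_derivative (\<lambda>v. u21 z * v$1 + u22 z * v$2)) (at z)"
    and c12: "continuous_on S u12" and c21: "continuous_on S u21"
  shows "u12 x = u21 x"
proof (rule ccontr)
  assume ne: "u12 x \<noteq> u21 x"
  have "isCont u12 x" "isCont u21 x"
    using assms continuous_on_eq_continuous_at by blast+
  then have lim: "(u12 \<longlongrightarrow> u12 x) (nhds x)" "(u21 \<longlongrightarrow> u21 x) (nhds x)"
    by (simp_all add: isCont_def tendsto_at_iff_tendsto_nhds)
  define \<epsilon> where "\<epsilon> = \<bar>u12 x - u21 x\<bar> / 2"
  then have "\<epsilon> > 0" using ne by simp
  have "\<forall>\<^sub>F z in nhds x. dist (u12 z) (u12 x) < \<epsilon> \<and> dist (u21 z) (u21 x) < \<epsilon> \<and> z \<in> S"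
    using tendstoD[OF lim(1) \<open>\<epsilon> > 0\<close>] tendstoD[OF lim(2) \<open>\<epsilon> > 0\<close>]
      eventually_nhds_in_open[OF assms(1,2)]
    by eventually_elim blast
  then obtain d where d: "d > 0" "\<And>z. dist z x < d \<Longrightarrow>
      dist (u12 z) (u12 x) < \<epsilon> \<and> dist (u21 z) (u21 x) < \<epsilon> \<and> z \<in> S"
    unfolding eventually_nhds_metric by blast
  define h where "h = d / 3"
  have "h > 0" using d by (simp add: h_def)
  define P where "P = (\<lambda>s t. x + s *\<^sub>R axis 1 1 + t *\<^sub>R (axis 2 1 :: real^2))"
  have near: "dist (P s t) x < d" if "0 \<le> s" "s \<le> h" "0 \<le> t" "t \<le> h" for s t
  proof -
    have "dist (P s t) x \<le> norm (s *\<^sub>R axis 1 1 :: real^2) + norm (t *\<^sub>R (axis 2 1 :: real^2))"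
      unfolding P_def dist_norm by (metis add.assoc add_diff_cancel_left' norm_triangle_ineq)
    then show ?thesis
      using that d by (simp add: h_def)
  qed
  have P': "P s t = x + t *\<^sub>R axis 2 1 + s *\<^sub>R axis 1 1" for s t
    by (simp add: P_def algebra_simps)
  have ax: "axis 1 1 $ 1 = (1::real)" "axis 1 1 $ (2::2) = (0::real)" "axis 2 1 $ (1::2) = (0::real)"
    "axis 2 1 $ (2::2) = (1::real)"
    by (simp_all add: axis_def)
  have D: "((\<lambda>s. u (P s t)) has_real_derivative u1 (P s t)) (at s)"
    "((\<lambda>t. u (P s t)) has_real_derivative u2 (P s t)) (at t)"
    "((\<lambda>t. u1 (P s t)) has_real_derivative u12 (P s t)) (at t)"
    "((\<lambda>s. u2 (P s t)) has_real_derivative u21 (P s t)) (at s)"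
    if "0 \<le> s" "s \<le> h" "0 \<le> t" "t \<le> h" for s t
  proof -
    have S: "P s t \<in> S" using d near that by blast
    show "((\<lambda>s. u (P s t)) has_real_derivative u1 (P s t)) (at s)"
      using DERIV_along_line[OF u[OF S, unfolded P']] by (simp add: P' ax)
    show "((\<lambda>t. u (P s t)) has_real_derivative u2 (P s t)) (at t)"
      using DERIV_along_line[OF u[OF S, unfolded P_def]] by (simp add: P_def ax)
    show "((\<lambda>t. u1 (P s t)) has_real_derivative u12 (P s t)) (at t)"
      using DERIV_along_line[OF u1[OF S, unfolded P_def]] by (simp add: P_def ax)
    show "((\<lambda>s. u2 (P s t)) has_real_derivative u21 (P s t)) (at s)"
      using DERIV_along_line[OF u2[OF S, unfolded P']] by (simp add: P' ax)
  qed
  obtain s t where st: "0 < s" "s < h" "0 < t" "t < h"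
    "u (P h h) - u (P h 0) - u (P 0 h) + u (P 0 0) = h\<^sup>2 * u12 (P s t)"
    using mixed_difference_mvt[OF \<open>h > 0\<close>, of "\<lambda>s t. u (P s t)" "\<lambda>s t. u1 (P s t)" "\<lambda>s t. u12 (P s t)", OF D(1) D(3)] by blast
  have D': "((\<lambda>t. u (P s t)) has_real_derivative u2 (P s t)) (at t)"
    "((\<lambda>s. u2 (P s t)) has_real_derivative u21 (P s t)) (at s)"
    if "0 \<le> t" "t \<le> h" "0 \<le> s" "s \<le> h" for s t
    using D(2,4) that by blast+
  obtain t' s' where st': "0 < t'" "t' < h" "0 < s'" "s' < h"
    "u (P h h) - u (P 0 h) - u (P h 0) + u (P 0 0) = h\<^sup>2 * u21 (P s' t')"
    using mixed_difference_mvt[OF \<open>h > 0\<close>, of "\<lambda>t s. u (P s t)" "\<lambda>t s. u2 (P s t)" "\<lambda>t s. u21 (P s t)", OF D'] by blast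
  have "h\<^sup>2 * u12 (P s t) = h\<^sup>2 * u21 (P s' t')"
    using st st' by linarith
  then have "u12 (P s t) = u21 (P s' t')"
    using \<open>h > 0\<close> by simp
  moreover have "dist (u12 (P s t)) (u12 x) < \<epsilon>" "dist (u21 (P s' t')) (u21 x) < \<epsilon>"
    using st st' near d(2) by (meson less_imp_le)+
  ultimately show False
    using dist_triangle2[of "u12 x" "u21 x" "u12 (P s t)"]
    by (simp add: \<epsilon>_def dist_commute dist_real_def[of "u12 x" "u21 x"])
qed

text \<open>\<open>Ck_on\<close> speaks only of partials along the axes. The contact argument needs
  a gradient differentiable in the full sense, to restrict to arbitrary lines and to bound the
  measure of its image, and a symmetric Hessian.\<close>

lemma Ck_on_2_derivatives:
  fixes u :: "real^2 \<Rightarrow> real"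
  assumes "open S" "Ck_on 2 u S"
  defines "D \<equiv> \<lambda>i. partial_deriv u i" and "H \<equiv> \<lambda>i j. partial_deriv (partial_deriv u i) j"
  shows "\<And>x. x \<in> S \<Longrightarrow> (u has_derivative (\<lambda>v. D 1 x * v$1 + D 2 x * v$2)) (at x)"
    and "\<And>x i. x \<in> S \<Longrightarrow> (D i has_derivative (\<lambda>v. H i 1 x * v$1 + H i 2 x * v$2)) (at x)"
    and "\<And>i j. continuous_on S (H i j)"
    and "\<And>x. x \<in> S \<Longrightarrow> H 2 1 x = H 1 2 x"
proof -
  have pd: "((\<lambda>t. f (x + t *\<^sub>R axis i 1)) has_real_derivative partial_deriv f i x) (at 0)"
    if "(\<lambda>t. f (x + t *\<^sub>R axis i 1)) differentiable (at 0)" for f and x :: "real^2" and i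
    using that by (simp add: partial_deriv_def DERIV_deriv_iff_real_differentiable)
  note C = assms(2)[unfolded numeral_2_eq_2 Ck_on.simps]
  show u: "(u has_derivative (\<lambda>v. D 1 x * v$1 + D 2 x * v$2)) (at x)" if "x \<in> S" for x
    using C unfolding D_def
    by (intro has_derivative_of_partials[OF \<open>open S\<close> that] pd) auto
  show D: "(D i has_derivative (\<lambda>v. H i 1 x * v$1 + H i 2 x * v$2)) (at x)" if "x \<in> S" for x i
    using C unfolding D_def H_def
    by (intro has_derivative_of_partials[OF \<open>open S\<close> that] pd) auto
  show c: "continuous_on S (H i j)" for i j
    using C by (auto simp: H_def)
  show "H 2 1 x = H 1 2 x" if "x \<in> S" for x
    using mixed_partials_commute[OF \<open>open S\<close> that u D D c c] by simp
qed

section \<open>Second-order conditions at an interior minimum\<close>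

lemma second_derivative_nonneg_at_min:
  fixes h :: "real \<Rightarrow> real"
  assumes "e > 0" and h: "\<And>t. \<bar>t\<bar> < e \<Longrightarrow> (h has_real_derivative h' t) (at t)"
    and h': "(h' has_real_derivative l) (at 0)"
    and min: "\<And>t. \<bar>t\<bar> < e \<Longrightarrow> h 0 \<le> h t"
  shows "h' 0 = 0" "0 \<le> l"
proof -
  show 0: "h' 0 = 0"
    using DERIV_local_min[OF h[of 0], of e] \<open>e > 0\<close> min by auto
  show "0 \<le> l"
  proof (rule ccontr)
    assume "\<not> 0 \<le> l"
    then obtain d where d: "d > 0" "\<And>t. 0 < t \<Longrightarrow> t < d \<Longrightarrow> h' t < 0"
      using DERIV_neg_dec_right[OF h'] 0 by auto
    define s where "s = min d e / 2"
    have s: "0 < s" "s < d" "s < e" using d \<open>e > 0\<close> by (auto simp: s_def)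
    obtain t where t: "0 < t" "t < s" "h s - h 0 = (s - 0) * h' t"
      using MVT2[of 0 s h h'] h s by (auto simp: abs_less_iff)
    have "h s < h 0"
      using t s d(2)[of t] mult_pos_neg[of s "h' t"] by simp
    then show False
      using min[of s] s by auto
  qed
qed

lemma psd_discriminant:
  fixes a b c :: real
  assumes "\<And>s t. 0 \<le> a * s\<^sup>2 + 2 * b * s * t + c * t\<^sup>2"
  shows "0 \<le> a" "0 \<le> c" "b\<^sup>2 \<le> a * c"
proof -
  show "0 \<le> a" "0 \<le> c"
    using assms[of 1 0] assms[of 0 1] by auto
  show "b\<^sup>2 \<le> a * c"
  proof (cases "a = 0")
    case True
    \<comment> \<open>For a = 0 the test vector (c + 1, -b) gives - b^2 (c + 2), which forces b = 0;
      otherwise (-b, a) gives a (a c - b^2).\<close>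
    have "0 \<le> a * (c + 1)\<^sup>2 + 2 * b * (c + 1) * (- b) + c * (- b)\<^sup>2" by (rule assms)
    then have "b\<^sup>2 * (c + 2) \<le> 0" using True by (simp add: power2_eq_square algebra_simps)
    then show ?thesis using True \<open>0 \<le> c\<close> by (auto simp: mult_le_0_iff)
  next
    case False
    have "0 \<le> a * (-b)\<^sup>2 + 2 * b * (-b) * a + c * a\<^sup>2" by (rule assms)
    then have "0 \<le> a * (a * c - b\<^sup>2)" by (simp add: power2_eq_square algebra_simps)
    then show ?thesis using False \<open>0 \<le> a\<close> by (auto simp: zero_le_mult_iff)
  qed
qed

text \<open>Restriction to the lines through \<open>x\<close> reduces the claim to one variable;
  nonnegativity of the Hessian in every direction then becomes scalar inequalities by
  \<open>psd_discriminant\<close>.\<close>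

lemma hessian_psd_at_min:
  fixes w :: "real^2 \<Rightarrow> real"
  assumes "open S" "x \<in> S"
    and w: "\<And>z. z \<in> S \<Longrightarrow> (w has_derivative (\<lambda>v. w1 z * v$1 + w2 z * v$2)) (at z)"
    and w1: "(w1 has_derivative (\<lambda>v. w11 * v$1 + w12 * v$2)) (at x)"
    and w2: "(w2 has_derivative (\<lambda>v. w12 * v$1 + w22 * v$2)) (at x)"
    and min: "\<And>z. z \<in> S \<Longrightarrow> w x \<le> w z"
  shows "w1 x = 0" "w2 x = 0" "0 \<le> w11" "0 \<le> w22" "w12\<^sup>2 \<le> w11 * w22"
proof -
  obtain e where e: "e > 0" "ball x e \<subseteq> S"
    using \<open>open S\<close> \<open>x \<in> S\<close> openE by blast
  have *: "w1 x * v$1 + w2 x * v$2 = 0 \<and> 0 \<le> w11 * (v$1)\<^sup>2 + 2 * w12 * v$1 * v$2 + w22 * (v$2)\<^sup>2"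
    for v :: "real^2"
  proof -
    define d where "d = e / (norm v + 1)"
    have "d > 0" using e by (simp add: d_def add_nonneg_pos)
    have S: "x + t *\<^sub>R v \<in> S" if "\<bar>t\<bar> < d" for t
    proof -
      have "\<bar>t\<bar> * (norm v + 1) < e"
        using that by (simp add: d_def pos_less_divide_eq add_nonneg_pos)
      moreover have "\<bar>t\<bar> * norm v \<le> \<bar>t\<bar> * (norm v + 1)" by (simp add: mult_left_mono)
      ultimately show ?thesis
        using e by (intro subsetD[OF e(2)]) (simp add: dist_norm)
    qed
    have h: "((\<lambda>t. w (x + t *\<^sub>R v)) has_real_derivative w1 (x + t *\<^sub>R v) * v$1 + w2 (x + t *\<^sub>R v) * v$2) (at t)"
      if "\<bar>t\<bar> < d" for t
      using DERIV_along_line[OF w[OF S[OF that]]] .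
    have "((\<lambda>t. w1 (x + t *\<^sub>R v) * v$1 + w2 (x + t *\<^sub>R v) * v$2) has_real_derivative
        (w11 * v$1 + w12 * v$2) * v$1 + (w12 * v$1 + w22 * v$2) * v$2) (at 0)"
      using DERIV_along_line[of w1 _ x 0 v] DERIV_along_line[of w2 _ x 0 v] w1 w2
      by (intro DERIV_add DERIV_cmult_right) auto
    note h' = this
    show ?thesis
      using second_derivative_nonneg_at_min[OF \<open>d > 0\<close> h h'] min[OF S]
      by (simp add: power2_eq_square algebra_simps)
  qed
  show "w1 x = 0" "w2 x = 0"
    using *[of "vector [1, 0]"] *[of "vector [0, 1]"] by auto
  have "0 \<le> w11 * s\<^sup>2 + 2 * w12 * s * t + w22 * t\<^sup>2" for s t
    using *[of "vector [s, t]"] by simp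
  from psd_discriminant[OF this] show "0 \<le> w11" "0 \<le> w22" "w12\<^sup>2 \<le> w11 * w22" .
qed

section \<open>Contact sets\<close>

text \<open>The preimage is closed relative to \<open>U\<close>, hence \<open>U\<close> intersected
  with a closed set. This serves functions that are arbitrary outside \<open>U\<close>.\<close>

lemma fmeasurable_Int_vimage_closed:
  fixes h :: "'a::euclidean_space \<Rightarrow> 'b::topological_space"
  assumes "B \<in> lmeasurable" "open U" "continuous_on U h" "closed T"
  shows "B \<inter> U \<inter> h -` T \<in> lmeasurable"
proof -
  have "closedin (top_of_set U) (U \<inter> h -` T)"
    using assms by (intro continuous_closedin_preimage)
  then obtain K where "closed K" "U \<inter> h -` T = U \<inter> K"
    by (auto simp: closedin_closed)
  then show ?thesis
    using assms by (simp add: fmeasurable_Int_fmeasurable Int_assoc borel_closed borel_open sets_completionI_sets)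
qed

text \<open>The Alexandrov--Bakelman--Pucci argument: for every slope q in the rectangle
  \<open>\<bar>q$1\<bar> \<le> \<delta>1, \<bar>q$2\<bar> \<le> \<delta>2\<close>, W minus the affine function with slope q attains its minimum over D
  in the interior, so q is a value of the gradient of W at a point with nonnegative Hessian, and the Jacobian
  of the gradient map is bounded there.\<close>

lemma contact_set_measure:
  fixes W :: "real^2 \<Rightarrow> real" and c x0 :: "real^2"
  assumes "open U"
    and W: "\<And>z. z \<in> U \<Longrightarrow> (W has_derivative (\<lambda>v. W1 z * v$1 + W2 z * v$2)) (at z)"
    and W1: "\<And>z. z \<in> U \<Longrightarrow> (W1 has_derivative (\<lambda>v. W11 z * v$1 + W12 z * v$2)) (at z)"
    and W2: "\<And>z. z \<in> U \<Longrightarrow> (W2 has_derivative (\<lambda>v. W12 z * v$1 + W22 z * v$2)) (at z)"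
    and cont: "continuous_on U W11" "continuous_on U W12" "continuous_on U W22"
    and D: "compact D" "D \<subseteq> U" "x0 \<in> D"
    and B: "B \<in> lmeasurable" "B \<subseteq> U"
    and \<delta>: "0 \<le> \<delta>1" "0 \<le> \<delta>2"
    and \<theta>: "\<And>z. z \<in> D \<Longrightarrow> \<delta>1 * \<bar>z$1 - c$1\<bar> + \<delta>2 * \<bar>z$2 - c$2\<bar> \<le> \<theta>"
    and bdry: "\<And>z. z \<in> frontier D \<Longrightarrow> W x0 + 2 * \<theta> < W z"
    and contact: "\<And>x. x \<in> interior D \<Longrightarrow> 0 \<le> W11 x \<Longrightarrow> 0 \<le> W22 x \<Longrightarrow> (W12 x)\<^sup>2 \<le> W11 x * W22 x \<Longrightarrow>
      x \<in> B \<and> W11 x * W22 x \<le> J"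
  shows "4 * \<delta>1 * \<delta>2 \<le> J * measure lebesgue {x \<in> B. W x \<le> W x0 + 2 * \<theta>}"
proof -
  define m where "m = W x0 + 2 * \<theta>"
  \<comment> \<open>Not the contact points themselves but a larger set cut out by closed conditions:
    it is measurable by continuity, and the last two conditions bound the Jacobian by
    \<open>J\<close>.\<close>
  define S where "S = {x \<in> B. W x \<le> m \<and> 0 \<le> W11 x \<and> 0 \<le> W22 x \<and>
    0 \<le> W11 x * W22 x - (W12 x)\<^sup>2 \<and> W11 x * W22 x \<le> J}"
  have W_cont: "continuous_on U W"
    using W has_derivative_continuous continuous_at_imp_continuous_on by blast
  note pre = fmeasurable_Int_vimage_closed[OF B(1) \<open>open U\<close>]
  have le_eq: "{x \<in> B. W x \<le> m} = B \<inter> U \<inter> W -` {..m}"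
    using B by auto
  have S_eq: "S = (B \<inter> U \<inter> W -` {..m}) \<inter> (B \<inter> U \<inter> W11 -` {0..}) \<inter> (B \<inter> U \<inter> W22 -` {0..}) \<inter>
     (B \<inter> U \<inter> (\<lambda>x. W11 x * W22 x - (W12 x)\<^sup>2) -` {0..}) \<inter> (B \<inter> U \<inter> (\<lambda>x. W11 x * W22 x) -` {..J})"
    using B by (auto simp: S_def)
  have S: "S \<in> lmeasurable"
    unfolding S_eq by (rule pre | rule fmeasurable.Int | rule W_cont cont continuous_intros | simp)+
  define f where "f = (\<lambda>x. W1 x *\<^sub>R axis 1 1 + W2 x *\<^sub>R (axis 2 1 :: real^2))"
  define f' where "f' = (\<lambda>x v :: real^2. (W11 x * v$1 + W12 x * v$2) *\<^sub>R axis 1 1 +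
    (W12 x * v$1 + W22 x * v$2) *\<^sub>R (axis 2 1 :: real^2))"
  have SU: "S \<subseteq> U" using B by (auto simp: S_def)
  have det: "det (matrix (f' x)) = W11 x * W22 x - (W12 x)\<^sup>2" for x
    by (simp add: det_2 matrix_def f'_def axis_def power2_eq_square)
  have det_le: "\<bar>det (matrix (f' x))\<bar> \<le> J" if "x \<in> S" for x
    using that unfolding det S_def by (auto simp: abs_le_iff intro: order_trans[of _ "W11 x * W22 x"])
  have df: "(f has_derivative f' x) (at x within S)" if "x \<in> S" for x
    unfolding f_def f'_def using that SU
    by (intro has_derivative_at_withinI[OF has_derivative_add] has_derivative_scaleR_left W1 W2) auto
  have int: "(\<lambda>x. \<bar>det (matrix (f' x))\<bar>) integrable_on S"
  proof (rule measurable_bounded_by_integrable_imp_integrable_real)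
    show "(\<lambda>x. \<bar>det (matrix (f' x))\<bar>) \<in> borel_measurable (lebesgue_on S)"
      unfolding det using S cont SU
      by (intro continuous_imp_measurable_on_sets_lebesgue continuous_intros fmeasurableD)
        (auto intro: continuous_on_subset)
    show "(\<lambda>x. J) integrable_on S" by (rule integrable_on_const[OF S])
  qed (use det_le S in \<open>auto simp: fmeasurableD\<close>)
  have image: "f ` S \<in> lmeasurable" "measure lebesgue (f ` S) \<le> J * measure lebesgue S"
    using measurable_bounded_differentiable_image[OF S df int det_le]
      measure_bounded_differentiable_image[OF S df int det_le] by auto
  define R where "R = cbox (vector [- \<delta>1, - \<delta>2]) (vector [\<delta>1, \<delta>2] :: real^2)"
  have "R \<subseteq> f ` S"
  proof
    fix q assume "q \<in> R"
    then have q: "\<bar>q$1\<bar> \<le> \<delta>1" "\<bar>q$2\<bar> \<le> \<delta>2"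
      by (auto simp: R_def mem_box_cart forall_2)
    define l where "l = (\<lambda>z :: real^2. q$1 * (z$1 - c$1) + q$2 * (z$2 - c$2))"
    have l: "\<bar>l z\<bar> \<le> \<theta>" if "z \<in> D" for z
    proof -
      have "\<bar>l z\<bar> \<le> \<bar>q$1\<bar> * \<bar>z$1 - c$1\<bar> + \<bar>q$2\<bar> * \<bar>z$2 - c$2\<bar>"
        by (metis abs_mult abs_triangle_ineq l_def)
      also have "\<dots> \<le> \<delta>1 * \<bar>z$1 - c$1\<bar> + \<delta>2 * \<bar>z$2 - c$2\<bar>"
        using q by (intro add_mono mult_right_mono) auto
      finally show ?thesis using \<theta>[OF that] by linarith
    qed
    have dl: "(l has_derivative (\<lambda>v. q$1 * v$1 + q$2 * v$2)) (at z)" for z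
      unfolding l_def by (auto intro!: derivative_eq_intros)
    define w where "w = (\<lambda>z. W z - l z)"
    have dw: "(w has_derivative (\<lambda>v. (W1 z - q$1) * v$1 + (W2 z - q$2) * v$2)) (at z)" if "z \<in> U" for z
      unfolding w_def using has_derivative_diff[OF W[OF that] dl[of z]] by (simp add: algebra_simps)
    have "continuous_on D w"
      using dw D by (meson continuous_at_imp_continuous_on has_derivative_continuous subsetD)
    then obtain x where x: "x \<in> D" "\<And>z. z \<in> D \<Longrightarrow> w x \<le> w z"
      using continuous_attains_inf[OF \<open>compact D\<close>, of w] \<open>x0 \<in> D\<close> by blast
    \<comment> \<open>Comparison with \<open>x0\<close> costs the affine function twice, at
      \<open>x\<close> and at \<open>x0\<close>; hence 2 \<theta> here and in
      \<open>bdry\<close>.\<close>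
    have Wx: "W x \<le> m"
      using x(2)[OF \<open>x0 \<in> D\<close>] l[OF \<open>x0 \<in> D\<close>] l[OF \<open>x \<in> D\<close>] by (simp add: w_def m_def abs_le_iff)
    then have "x \<notin> frontier D"
      using bdry[of x] by (auto simp: m_def)
    then have xi: "x \<in> interior D"
      using \<open>x \<in> D\<close> closure_subset by (auto simp: frontier_def)
    have "interior D \<subseteq> D" "x \<in> U" using D x interior_subset by auto
    have "((\<lambda>z. W1 z - q$1) has_derivative (\<lambda>v. W11 x * v$1 + W12 x * v$2)) (at x)"
      "((\<lambda>z. W2 z - q$2) has_derivative (\<lambda>v. W12 x * v$1 + W22 x * v$2)) (at x)"
      using has_derivative_diff[OF W1 has_derivative_const] has_derivative_diff[OF W2 has_derivative_const] \<open>x \<in> U\<close>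
      by auto
    note hess = hessian_psd_at_min[OF open_interior xi dw this x(2)]
    have psd: "W1 x - q$1 = 0" "W2 x - q$2 = 0" "0 \<le> W11 x" "0 \<le> W22 x" "(W12 x)\<^sup>2 \<le> W11 x * W22 x"
      using hess \<open>interior D \<subseteq> D\<close> D by blast+
    have "f x = q"
      using psd(1,2) by (auto simp: f_def vec_eq_iff forall_2 axis_def)
    moreover have "x \<in> S"
      using contact[OF xi] psd Wx by (auto simp: S_def)
    ultimately show "q \<in> f ` S" by blast
  qed
  then have "measure lebesgue R \<le> measure lebesgue (f ` S)"
    by (intro measure_mono_fmeasurable image) (auto simp: R_def)
  moreover have "0 \<in> R"
    using \<delta> by (simp add: R_def mem_box_cart forall_2)
  moreover from this have "measure lebesgue R = 4 * \<delta>1 * \<delta>2"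
    using \<delta> by (auto simp: R_def content_cbox_if_cart UNIV_2)
  moreover have "J * measure lebesgue S \<le> J * measure lebesgue {x \<in> B. W x \<le> m}"
  \<comment> \<open>\<open>J\<close> carries no sign assumption. A point of \<open>S\<close> forces
    0 \<le> J, and \<open>S\<close> cannot be empty because its image contains the slope 0.\<close>
  proof (cases "S = {}")
    case False
    then have "0 \<le> J" using det_le abs_ge_zero order_trans by blast
    moreover have "{x \<in> B. W x \<le> m} \<in> lmeasurable"
      unfolding le_eq by (intro pre W_cont) auto
    ultimately show ?thesis
      using S by (intro mult_left_mono measure_mono_fmeasurable) (auto simp: S_def fmeasurableD)
  next
    case True
    then show ?thesis using \<open>R \<subseteq> f ` S\<close> \<open>0 \<in> R\<close> by simp
  qed
  ultimately show ?thesis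
    using image(2) unfolding m_def by linarith
qed

text \<open>The trace of the product of two nonnegative matrices, here A - lam I and N, is
  nonnegative: |a12 n12| \<le> sqrt (b1 b2) \<le> (b1 + b2) / 2. It is applied to the horizontal
  Hessian with entries W11, x1 W12, x1^2 W22.\<close>

lemma trace_lower_bound:
  fixes a11 a12 a22 n11 n12 n22 lam Lam :: real
  assumes ell: "\<And>s t. lam * (s\<^sup>2 + t\<^sup>2) \<le> a11 * s\<^sup>2 + 2 * a12 * s * t + a22 * t\<^sup>2"
    and n: "0 \<le> n11" "0 \<le> n22" "n12\<^sup>2 \<le> n11 * n22"
  shows "lam * (n11 + n22) \<le> a11 * n11 + 2 * a12 * n12 + a22 * n22"
proof -
  have "0 \<le> (a11 - lam) * s\<^sup>2 + 2 * a12 * s * t + (a22 - lam) * t\<^sup>2" for s t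
    using ell[of s t] by (simp add: algebra_simps)
  note a = psd_discriminant[OF this]
  define b1 b2 where "b1 = (a11 - lam) * n11" and "b2 = (a22 - lam) * n22"
  have b: "0 \<le> b1" "0 \<le> b2" using a n by (auto simp: b1_def b2_def)
  have "(a12 * n12)\<^sup>2 \<le> ((a11 - lam) * (a22 - lam)) * (n11 * n22)"
    unfolding power_mult_distrib by (intro mult_mono a n mult_nonneg_nonneg zero_le_power2)
  also have "\<dots> = b1 * b2"
    by (simp add: b1_def b2_def)
  also have "\<dots> \<le> ((b1 + b2) / 2)\<^sup>2"
    using zero_le_power2[of "b1 - b2"] by (simp add: power2_eq_square field_simps)
  finally have "\<bar>a12 * n12\<bar> \<le> (b1 + b2) / 2"
    using b by (simp add: abs_le_square_iff[symmetric])
  then have "0 \<le> b1 + b2 + 2 * a12 * n12"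
    by (auto simp: abs_le_iff algebra_simps)
  then show ?thesis
    by (simp add: b1_def b2_def algebra_simps)
qed

section \<open>The barrier\<close>

text \<open>The function Q of the overview. The set {Q < s} has area \<pi> s / sqrt (\<alpha>
  \<beta>), so 1 / sqrt (\<alpha> \<beta>) is the natural unit of measure below.\<close>

definition ellipse :: "real \<Rightarrow> real \<Rightarrow> real^2 \<Rightarrow> real^2 \<Rightarrow> real" where
  "ellipse \<alpha> \<beta> c x = \<alpha> * (x$1 - c$1)\<^sup>2 + \<beta> * (x$2 - c$2)\<^sup>2"

lemma exp_ellipse_derivatives:
  fixes c :: "real^2" and p \<alpha> \<beta> :: real
  defines "E \<equiv> \<lambda>x. exp (- p * ellipse \<alpha> \<beta> c x)"
  shows "(E has_derivative (\<lambda>v. (-2 * p * \<alpha> * (z$1 - c$1) * E z) * v$1 +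
      (-2 * p * \<beta> * (z$2 - c$2) * E z) * v$2)) (at z)" (is ?E)
    and "((\<lambda>x. -2 * p * \<alpha> * (x$1 - c$1) * E x) has_derivative
      (\<lambda>v. ((4 * p\<^sup>2 * \<alpha>\<^sup>2 * (z$1 - c$1)\<^sup>2 - 2 * p * \<alpha>) * E z) * v$1 +
        (4 * p\<^sup>2 * \<alpha> * \<beta> * (z$1 - c$1) * (z$2 - c$2) * E z) * v$2)) (at z)"
    and "((\<lambda>x. -2 * p * \<beta> * (x$2 - c$2) * E x) has_derivative
      (\<lambda>v. (4 * p\<^sup>2 * \<alpha> * \<beta> * (z$1 - c$1) * (z$2 - c$2) * E z) * v$1 +
        ((4 * p\<^sup>2 * \<beta>\<^sup>2 * (z$2 - c$2)\<^sup>2 - 2 * p * \<beta>) * E z) * v$2)) (at z)"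
proof -
  show E: ?E
    unfolding E_def ellipse_def
    by (auto intro!: derivative_eq_intros simp: algebra_simps)
  show "((\<lambda>x. -2 * p * \<alpha> * (x$1 - c$1) * E x) has_derivative
      (\<lambda>v. ((4 * p\<^sup>2 * \<alpha>\<^sup>2 * (z$1 - c$1)\<^sup>2 - 2 * p * \<alpha>) * E z) * v$1 +
        (4 * p\<^sup>2 * \<alpha> * \<beta> * (z$1 - c$1) * (z$2 - c$2) * E z) * v$2)) (at z)"
    by (rule derivative_eq_intros E refl)+ (simp add: fun_eq_iff power2_eq_square algebra_simps)
  show "((\<lambda>x. -2 * p * \<beta> * (x$2 - c$2) * E x) has_derivative
      (\<lambda>v. (4 * p\<^sup>2 * \<alpha> * \<beta> * (z$1 - c$1) * (z$2 - c$2) * E z) * v$1 +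
        ((4 * p\<^sup>2 * \<beta>\<^sup>2 * (z$2 - c$2)\<^sup>2 - 2 * p * \<beta>) * E z) * v$2)) (at z)"
    by (rule derivative_eq_intros E refl)+ (simp add: fun_eq_iff power2_eq_square algebra_simps)
qed

section \<open>Topology and measurability of the ellipses\<close>

lemma compact_ellipse:
  assumes "0 < \<alpha>" "0 < \<beta>"
  shows "compact {x. ellipse \<alpha> \<beta> c x \<le> r}"
proof -
  have "{x. ellipse \<alpha> \<beta> c x \<le> r} \<subseteq>
    cbox (vector [c$1 - sqrt (r / \<alpha>), c$2 - sqrt (r / \<beta>)]) (vector [c$1 + sqrt (r / \<alpha>), c$2 + sqrt (r / \<beta>)])"
  proof clarify
    fix x assume "ellipse \<alpha> \<beta> c x \<le> r"
    moreover have "0 \<le> \<alpha> * (x$1 - c$1)\<^sup>2" "0 \<le> \<beta> * (x$2 - c$2)\<^sup>2"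
      using assms by auto
    ultimately have "\<alpha> * (x$1 - c$1)\<^sup>2 \<le> r" "\<beta> * (x$2 - c$2)\<^sup>2 \<le> r"
      by (auto simp: ellipse_def)
    then have "(x$1 - c$1)\<^sup>2 \<le> r / \<alpha>" "(x$2 - c$2)\<^sup>2 \<le> r / \<beta>"
      using assms by (auto simp: field_simps)
    then have "\<bar>x$1 - c$1\<bar> \<le> sqrt (r / \<alpha>)" "\<bar>x$2 - c$2\<bar> \<le> sqrt (r / \<beta>)"
      by (auto intro: real_le_rsqrt)
    then show "x \<in> cbox (vector [c$1 - sqrt (r / \<alpha>), c$2 - sqrt (r / \<beta>)])
        (vector [c$1 + sqrt (r / \<alpha>), c$2 + sqrt (r / \<beta>)])"
      by (auto simp: mem_box_cart forall_2 abs_le_iff)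
  qed
  then have "bounded {x. ellipse \<alpha> \<beta> c x \<le> r}"
    using bounded_cbox bounded_subset by blast
  moreover have "closed {x. ellipse \<alpha> \<beta> c x \<le> r}"
    unfolding ellipse_def by (intro closed_Collect_le continuous_intros)
  ultimately show ?thesis
    by (simp add: compact_eq_bounded_closed)
qed

lemma open_ellipse: "open {x. ellipse \<alpha> \<beta> c x < r}"
  unfolding ellipse_def by (intro open_Collect_less continuous_intros)

lemma fmeasurable_ellipse:
  assumes "0 < \<alpha>" "0 < \<beta>"
  shows "{x. ellipse \<alpha> \<beta> c x < r} \<in> lmeasurable"
proof (rule lmeasurable_open[OF _ open_ellipse])
  show "bounded {x. ellipse \<alpha> \<beta> c x < r}"
    by (rule bounded_subset[OF compact_imp_bounded[OF compact_ellipse[OF assms, of c r]]]) auto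
qed

lemma frontier_ellipse_subset: "frontier {x. ellipse \<alpha> \<beta> c x \<le> r} \<subseteq> {x. ellipse \<alpha> \<beta> c x = r}"
proof -
  have "closed {x. ellipse \<alpha> \<beta> c x \<le> r}"
    unfolding ellipse_def by (intro closed_Collect_le continuous_intros)
  moreover have "{x. ellipse \<alpha> \<beta> c x < r} \<subseteq> interior {x. ellipse \<alpha> \<beta> c x \<le> r}"
    by (intro interior_maximal open_ellipse) auto
  ultimately show ?thesis
    by (force simp: frontier_def)
qed

text \<open>The condition on c1 keeps the centre away from the axis x1 = 0, where the second component of the
  horizontal gradient degenerates; there the first component is bounded below instead.\<close>

lemma horizontal_gradient_lower_bound:
  fixes \<alpha> \<beta> c1 x1 s t :: real
  assumes "0 < \<alpha>" "0 < \<beta>" "1/1000 \<le> \<alpha> * c1\<^sup>2" "\<alpha> / 200 \<le> \<beta> * c1\<^sup>2"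
    and "s = x1 - c1" "1/2000 \<le> \<alpha> * s\<^sup>2 + \<beta> * t\<^sup>2"
  shows "\<alpha> / 3200000 \<le> (\<alpha> * s)\<^sup>2 + (x1 * \<beta> * t)\<^sup>2"
proof (cases "1/4000 \<le> \<alpha> * s\<^sup>2")
  case True
  have "\<alpha> / 3200000 \<le> \<alpha> * (1/4000)" using assms by simp
  also have "\<dots> \<le> \<alpha> * (\<alpha> * s\<^sup>2)" using True assms by (intro mult_left_mono) auto
  also have "\<dots> = (\<alpha> * s)\<^sup>2" by (simp add: power2_eq_square)
  finally show ?thesis by (simp add: add_increasing2)
next
  case False
  \<comment> \<open>If the x1 part carries less than half of the core level 1/2000, then |x1| \<ge>
    |c1| / 2 and the x2 part carries the other half. The product of the bounds 1/800 and 1/4000 is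
    the constant of the claim.\<close>
  then have "\<alpha> * s\<^sup>2 \<le> \<alpha> * (c1 / 2)\<^sup>2" using assms(3) by (simp add: power_divide)
  then have "\<bar>s\<bar> \<le> \<bar>c1 / 2\<bar>" using assms(1) by (simp only: mult_le_cancel_left_pos abs_le_square_iff)
  then have "\<bar>c1 / 2\<bar> \<le> \<bar>x1\<bar>" using assms by linarith
  then have "(c1 / 2)\<^sup>2 \<le> x1\<^sup>2" by (simp only: abs_le_square_iff)
  then have "\<beta> * (c1 / 2)\<^sup>2 \<le> \<beta> * x1\<^sup>2" using assms by (intro mult_left_mono) auto
  then have "\<alpha> / 800 \<le> \<beta> * x1\<^sup>2" using assms(4) by (simp add: power_divide)
  moreover have "1/4000 \<le> \<beta> * t\<^sup>2" using assms False by linarith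
  ultimately have "\<alpha> / 800 * (1/4000) \<le> (\<beta> * x1\<^sup>2) * (\<beta> * t\<^sup>2)"
    using assms by (intro mult_mono) auto
  also have "\<dots> = (x1 * \<beta> * t)\<^sup>2" by (simp add: power2_eq_square)
  finally show ?thesis by (simp add: add_increasing)
qed

text \<open>The right-hand side is L applied to exp (- p Q), divided by exp (- p Q). Lower
  ellipticity acts on the part quadratic in p, a multiple of the form at the horizontal gradient of
  Q; the part linear in p is bounded using a11, a22 \<le> Lam, and 14 = 2 (1 + 6) with the 6 of the
  hypothesis.\<close>

lemma grushin_exp_ellipse_ge:
  fixes a11 a12 a22 lam Lam p \<alpha> \<beta> s t x1 :: real
  assumes ell: "\<And>s t. lam * (s\<^sup>2 + t\<^sup>2) \<le> a11 * s\<^sup>2 + 2 * a12 * s * t + a22 * t\<^sup>2"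
      "\<And>s t. a11 * s\<^sup>2 + 2 * a12 * s * t + a22 * t\<^sup>2 \<le> Lam * (s\<^sup>2 + t\<^sup>2)"
    and "0 < \<alpha>" "0 < \<beta>" "0 < p" "0 < Lam" "\<beta> * x1\<^sup>2 \<le> 6 * \<alpha>"
  shows "4 * p\<^sup>2 * lam * ((\<alpha> * s)\<^sup>2 + (x1 * \<beta> * t)\<^sup>2) - 14 * p * Lam * \<alpha> \<le>
    a11 * (4 * p\<^sup>2 * \<alpha>\<^sup>2 * s\<^sup>2 - 2 * p * \<alpha>) + 2 * a12 * (x1 * (4 * p\<^sup>2 * \<alpha> * \<beta> * s * t)) +
    a22 * (x1\<^sup>2 * (4 * p\<^sup>2 * \<beta>\<^sup>2 * t\<^sup>2 - 2 * p * \<beta>))"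
proof -
  have "a11 \<le> Lam" "a22 \<le> Lam"
    using ell(2)[of 1 0] ell(2)[of 0 1] by auto
  then have "a11 * \<alpha> + a22 * (\<beta> * x1\<^sup>2) \<le> Lam * \<alpha> + Lam * (\<beta> * x1\<^sup>2)"
    using assms by (intro add_mono mult_right_mono) auto
  also have "\<dots> \<le> Lam * \<alpha> + Lam * (6 * \<alpha>)"
    using assms by (intro add_left_mono mult_left_mono) auto
  finally have "2 * p * (a11 * \<alpha> + a22 * (\<beta> * x1\<^sup>2)) \<le> 2 * p * (7 * Lam * \<alpha>)"
    using assms by (intro mult_left_mono) auto
  moreover have "4 * p\<^sup>2 * (lam * ((\<alpha> * s)\<^sup>2 + (x1 * \<beta> * t)\<^sup>2)) \<le>
      4 * p\<^sup>2 * (a11 * (\<alpha> * s)\<^sup>2 + 2 * a12 * (\<alpha> * s) * (x1 * \<beta> * t) + a22 * (x1 * \<beta> * t)\<^sup>2)"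
    using ell(1) by (intro mult_left_mono) auto
  ultimately show ?thesis
    by (simp add: power2_eq_square algebra_simps)
qed

text \<open>The constants are fixed before the ellipse. This is possible because the conditions on
  \<open>\<alpha>\<close>, \<open>\<beta>\<close>, \<open>c\<close> are invariant under the
  dilations (x1, x2) \<mapsto> (r x1, r^2 x2) and enter only through fixed numerical bounds.\<close>

lemma sublevel_measure_in_ellipse:
  fixes lam Lam :: real
  assumes lam: "0 < lam" "lam \<le> Lam"
  obtains \<nu> M :: real where "0 < \<nu>" "1 < M"
    "\<And>a11 a12 a22 \<alpha> \<beta> c u U x0. ellipticity_constants lam Lam a11 a12 a22 \<Longrightarrow> 0 < \<alpha> \<Longrightarrow> 0 < \<beta> \<Longrightarrow>
      1/1000 \<le> \<alpha> * (c$1)\<^sup>2 \<Longrightarrow> \<alpha> / 200 \<le> \<beta> * (c$1)\<^sup>2 \<Longrightarrow>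
      (\<And>x. ellipse \<alpha> \<beta> c x \<le> 1 \<Longrightarrow> \<beta> * (x$1)\<^sup>2 \<le> 6 * \<alpha>) \<Longrightarrow>
      open U \<Longrightarrow> {x. ellipse \<alpha> \<beta> c x \<le> 1} \<subseteq> U \<Longrightarrow> Ck_on 2 u U \<Longrightarrow> (\<And>x. x \<in> U \<Longrightarrow> 0 \<le> u x) \<Longrightarrow>
      (\<And>x. x \<in> U \<Longrightarrow> grushin_op a11 a12 a22 u x \<le> 0) \<Longrightarrow>
      ellipse \<alpha> \<beta> c x0 \<le> 9/10 \<Longrightarrow> u x0 \<le> 3/2 \<Longrightarrow>
      \<nu> / sqrt (\<alpha> * \<beta>) \<le> measure lebesgue {x. ellipse \<alpha> \<beta> c x < 1/2000 \<and> u x \<le> M}"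
proof -
  \<comment> \<open>p is so large that the barrier is a strict subsolution outside the core; K makes it at least 2 on the inner ellipse.\<close>
  define p where "p = 20000000 * Lam / lam"
  define K where "K = 2 / (exp (- p * (9/10)) - exp (- p))"
  \<comment> \<open>The squared trace bound at contact points times 800 = 3200 / 4: the core
    satisfies \<alpha> / 3200 \<le> \<beta> x1^2, and a product is at most a quarter of the squared
    sum.\<close>
  define J0 where "J0 = 800 * (14 * K * p * Lam / lam)\<^sup>2"
  have "0 < Lam" using lam by linarith
  have "0 < p" using lam by (simp add: p_def)
  have "exp (- p) < exp (- p * (9/10))" using \<open>0 < p\<close> by simp
  then have "0 < K" by (simp add: K_def)
  have "0 < J0" using \<open>0 < p\<close> \<open>0 < K\<close> \<open>0 < Lam\<close> lam by (simp add: J0_def)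
  have K: "K * exp (- p * (9/10)) - K * exp (- p) = 2"
    using \<open>exp (- p) < exp (- p * (9/10))\<close> unfolding K_def right_diff_distrib[symmetric]
    by (subst times_divide_eq_left, subst nonzero_mult_div_cancel_right) auto
  show thesis
  proof (rule that)
    show "0 < 1 / (64 * J0)" using \<open>0 < J0\<close> by simp
    show "1 < K + 2" using \<open>0 < K\<close> by simp
    fix a11 a12 a22 u :: "real^2 \<Rightarrow> real" and \<alpha> \<beta> :: real and c x0 :: "real^2" and U
    assume ell: "ellipticity_constants lam Lam a11 a12 a22" and \<alpha>\<beta>: "0 < \<alpha>" "0 < \<beta>"
      and c: "1/1000 \<le> \<alpha> * (c$1)\<^sup>2" "\<alpha> / 200 \<le> \<beta> * (c$1)\<^sup>2"
      and x1: "\<And>x. ellipse \<alpha> \<beta> c x \<le> 1 \<Longrightarrow> \<beta> * (x$1)\<^sup>2 \<le> 6 * \<alpha>"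
      and U: "open U" "{x. ellipse \<alpha> \<beta> c x \<le> 1} \<subseteq> U" and u: "Ck_on 2 u U" "\<And>x. x \<in> U \<Longrightarrow> 0 \<le> u x"
        "\<And>x. x \<in> U \<Longrightarrow> grushin_op a11 a12 a22 u x \<le> 0"
      and x0: "ellipse \<alpha> \<beta> c x0 \<le> 9/10" "u x0 \<le> 3/2"
    have e: "lam * (s\<^sup>2 + t\<^sup>2) \<le> a11 x * s\<^sup>2 + 2 * a12 x * s * t + a22 x * t\<^sup>2"
      "a11 x * s\<^sup>2 + 2 * a12 x * s * t + a22 x * t\<^sup>2 \<le> Lam * (s\<^sup>2 + t\<^sup>2)" for x s t
      using ell[unfolded ellipticity_constants_def, rule_format, where \<xi> = "vector [s, t]"] by auto
    have ellipse_nonneg: "0 \<le> ellipse \<alpha> \<beta> c x" for x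
      using \<alpha>\<beta> by (simp add: ellipse_def)
    define E where "E x = exp (- p * ellipse \<alpha> \<beta> c x)" for x
    define E11 where "E11 x = (4 * p\<^sup>2 * \<alpha>\<^sup>2 * (x$1 - c$1)\<^sup>2 - 2 * p * \<alpha>) * E x" for x
    define E12 where "E12 x = 4 * p\<^sup>2 * \<alpha> * \<beta> * (x$1 - c$1) * (x$2 - c$2) * E x" for x
    define E22 where "E22 x = (4 * p\<^sup>2 * \<beta>\<^sup>2 * (x$2 - c$2)\<^sup>2 - 2 * p * \<beta>) * E x" for x
    note dE = exp_ellipse_derivatives[where p = p and \<alpha> = \<alpha> and \<beta> = \<beta> and c = c, folded E_def, folded E11_def E12_def E22_def]
    note du = Ck_on_2_derivatives[OF U(1) u(1)]
    have du2: "(partial_deriv u 2 has_derivative (\<lambda>v. partial_deriv (partial_deriv u 1) 2 z * v$1 +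
        partial_deriv (partial_deriv u 2) 2 z * v$2)) (at z)" if "z \<in> U" for z
      using du(2)[OF that, of 2] du(4)[OF that] by simp
    define W where "W = (\<lambda>x. u x - K * E x)"
    define W1 where "W1 = (\<lambda>x. partial_deriv u 1 x - K * (-2 * p * \<alpha> * (x$1 - c$1) * E x))"
    define W2 where "W2 = (\<lambda>x. partial_deriv u 2 x - K * (-2 * p * \<beta> * (x$2 - c$2) * E x))"
    define W11 where "W11 = (\<lambda>x. partial_deriv (partial_deriv u 1) 1 x - K * E11 x)"
    define W12 where "W12 = (\<lambda>x. partial_deriv (partial_deriv u 1) 2 x - K * E12 x)"
    define W22 where "W22 = (\<lambda>x. partial_deriv (partial_deriv u 2) 2 x - K * E22 x)"
    have comb: "((\<lambda>x. f x - K * h x) has_derivative (\<lambda>v. (f1 - K * h1) * v$1 + (f2 - K * h2) * v$2)) (at z)"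
      if "(f has_derivative (\<lambda>v. f1 * v$1 + f2 * v$2)) (at z)" "(h has_derivative (\<lambda>v. h1 * v$1 + h2 * v$2)) (at z)"
      for f h :: "real^2 \<Rightarrow> real" and f1 f2 h1 h2 z
      using has_derivative_diff[OF that(1) has_derivative_mult_right[OF that(2), of K]]
      by (simp add: algebra_simps)
    have E_cont: "continuous_on U E11" "continuous_on U E12" "continuous_on U E22"
      unfolding E11_def E12_def E22_def E_def ellipse_def by (intro continuous_intros)+
    \<comment> \<open>On the ellipse sqrt \<alpha> |x1 - c1| and sqrt \<beta> |x2 - c2| are at most
      1, so the affine functions stay within \<theta> = 1/8, while the slopes fill an area sqrt
      (\<alpha> \<beta>) / 64.\<close>
    define \<delta>1 \<delta>2 where "\<delta>1 = sqrt \<alpha> / 16" and "\<delta>2 = sqrt \<beta> / 16"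
    define D where "D = {x. ellipse \<alpha> \<beta> c x \<le> 1}"
    define B where "B = {x. ellipse \<alpha> \<beta> c x < 1/2000}"
    have "B \<subseteq> D" by (auto simp: B_def D_def)
    have "compact D" unfolding D_def using \<alpha>\<beta> by (rule compact_ellipse)
    have "B \<in> lmeasurable"
      unfolding B_def using \<alpha>\<beta> by (rule fmeasurable_ellipse)
    define m where "m = measure lebesgue {x. ellipse \<alpha> \<beta> c x < 1/2000 \<and> u x \<le> K + 2}"
    have "4 * \<delta>1 * \<delta>2 \<le> (J0 * \<alpha> * \<beta>) * measure lebesgue {x \<in> B. W x \<le> W x0 + 2 * (1/8)}"
    proof (rule contact_set_measure[OF U(1), where D = D and c = c])
      show "(W has_derivative (\<lambda>v. W1 z * v$1 + W2 z * v$2)) (at z)"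
        "(W1 has_derivative (\<lambda>v. W11 z * v$1 + W12 z * v$2)) (at z)"
        "(W2 has_derivative (\<lambda>v. W12 z * v$1 + W22 z * v$2)) (at z)" if "z \<in> U" for z
        unfolding W_def W1_def W2_def W11_def W12_def W22_def
        by (intro comb du(1,2) du2 dE that)+
      show "continuous_on U W11" "continuous_on U W12" "continuous_on U W22"
        unfolding W11_def W12_def W22_def by (intro continuous_intros du(3) E_cont)+
      show "compact D" by fact
      show "D \<subseteq> U" using U by (simp add: D_def)
      show "x0 \<in> D" using x0 by (simp add: D_def)
      show "B \<in> lmeasurable" by fact
      show "B \<subseteq> U" using \<open>B \<subseteq> D\<close> U by (auto simp: D_def)
      show "0 \<le> \<delta>1" "0 \<le> \<delta>2" using \<alpha>\<beta> by (auto simp: \<delta>1_def \<delta>2_def)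
      show "\<delta>1 * \<bar>z$1 - c$1\<bar> + \<delta>2 * \<bar>z$2 - c$2\<bar> \<le> 1/8" if "z \<in> D" for z
      proof -
        have "(sqrt \<alpha> * \<bar>z$1 - c$1\<bar>)\<^sup>2 + (sqrt \<beta> * \<bar>z$2 - c$2\<bar>)\<^sup>2 \<le> 1"
          using that \<alpha>\<beta> by (simp add: D_def ellipse_def power_mult_distrib)
        then have "(sqrt \<alpha> * \<bar>z$1 - c$1\<bar>)\<^sup>2 \<le> 1\<^sup>2" "(sqrt \<beta> * \<bar>z$2 - c$2\<bar>)\<^sup>2 \<le> 1\<^sup>2"
          using zero_le_power2[of "sqrt \<alpha> * \<bar>z$1 - c$1\<bar>"] zero_le_power2[of "sqrt \<beta> * \<bar>z$2 - c$2\<bar>"]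
          unfolding one_power2 by linarith+
        then have "sqrt \<alpha> * \<bar>z$1 - c$1\<bar> \<le> 1" "sqrt \<beta> * \<bar>z$2 - c$2\<bar> \<le> 1"
          by (auto intro: power2_le_imp_le)
        then show ?thesis by (simp add: \<delta>1_def \<delta>2_def)
      qed
      show "W x0 + 2 * (1/8) < W z" if "z \<in> frontier D" for z
      proof -
        have z: "ellipse \<alpha> \<beta> c z = 1"
          using that subsetD[OF frontier_ellipse_subset] unfolding D_def by blast
        then have "z \<in> U" using U by auto
        \<comment> \<open>The barrier is at least 2 at \<open>x0\<close>, hence W x0 \<le> -1/2 - K
          exp (- p); on Q = 1, u \<ge> 0 gives W \<ge> - K exp (- p). The gap 1/2 exceeds 2 \<theta>
          = 1/4.\<close>
        have "exp (- p * (9/10)) \<le> E x0"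
          using x0 \<open>0 < p\<close> by (simp add: E_def)
        then have "K * exp (- p * (9/10)) \<le> K * E x0"
          using \<open>0 < K\<close> by (intro mult_left_mono) auto
        then show ?thesis
          using u(2)[OF \<open>z \<in> U\<close>] x0(2) K by (simp add: W_def E_def z)
      qed
      show "x \<in> B \<and> W11 x * W22 x \<le> J0 * \<alpha> * \<beta>"
        if x: "x \<in> interior D" and psd: "0 \<le> W11 x" "0 \<le> W22 x" "(W12 x)\<^sup>2 \<le> W11 x * W22 x" for x
      proof -
        have Q: "ellipse \<alpha> \<beta> c x \<le> 1" "x \<in> U"
          using subsetD[OF interior_subset x] U by (auto simp: D_def)
        define L where "L = a11 x * (4 * p\<^sup>2 * \<alpha>\<^sup>2 * (x$1 - c$1)\<^sup>2 - 2 * p * \<alpha>) +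
          2 * a12 x * (x$1 * (4 * p\<^sup>2 * \<alpha> * \<beta> * (x$1 - c$1) * (x$2 - c$2))) +
          a22 x * ((x$1)\<^sup>2 * (4 * p\<^sup>2 * \<beta>\<^sup>2 * (x$2 - c$2)\<^sup>2 - 2 * p * \<beta>))"
        define N where "N = (\<alpha> * (x$1 - c$1))\<^sup>2 + (x$1 * \<beta> * (x$2 - c$2))\<^sup>2"
        have L: "4 * p\<^sup>2 * lam * N - 14 * p * Lam * \<alpha> \<le> L"
          unfolding L_def N_def using \<alpha>\<beta> \<open>0 < p\<close> \<open>0 < Lam\<close> x1[OF Q(1)] by (intro grushin_exp_ellipse_ge e)
        have "lam * (W11 x + (x$1)\<^sup>2 * W22 x) \<le>
            a11 x * W11 x + 2 * a12 x * (x$1 * W12 x) + a22 x * ((x$1)\<^sup>2 * W22 x)"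
        proof (rule trace_lower_bound[OF e(1)])
          have "(x$1)\<^sup>2 * (W12 x)\<^sup>2 \<le> (x$1)\<^sup>2 * (W11 x * W22 x)"
            using psd by (intro mult_left_mono) auto
          then show "(x$1 * W12 x)\<^sup>2 \<le> W11 x * ((x$1)\<^sup>2 * W22 x)"
            by (simp add: power_mult_distrib algebra_simps)
        qed (use psd in auto)
        also have "\<dots> = grushin_op a11 a12 a22 u x - K * E x * L"
          unfolding grushin_op_eq[OF u(1) Q(2)] W11_def W12_def W22_def L_def E11_def E12_def E22_def
          by (simp add: algebra_simps)
        also have "\<dots> \<le> K * E x * (- L)"
          using u(3)[OF Q(2)] by simp
        finally have tr: "lam * (W11 x + (x$1)\<^sup>2 * W22 x) \<le> K * E x * (- L)" .
        have E: "0 < E x" "E x \<le> 1"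
          using ellipse_nonneg[of x] \<open>0 < p\<close> by (auto simp: E_def)
        \<comment> \<open>By \<open>tr\<close> a contact point needs L \<le> 0. The factor 20000000
          in \<open>p\<close> makes the gradient term at least 25 p Lam \<alpha> outside the core,
          against the loss of 14 p Lam \<alpha>.\<close>
        have "x \<in> B"
        proof (rule ccontr)
          assume "x \<notin> B"
          then have "\<alpha> / 3200000 \<le> N"
            unfolding N_def using \<alpha>\<beta> c by (intro horizontal_gradient_lower_bound) (auto simp: B_def ellipse_def)
          then have "(4 * p * (p * lam)) * (\<alpha> / 3200000) \<le> (4 * p * (p * lam)) * N"
            using \<open>0 < p\<close> lam by (intro mult_left_mono) auto
          moreover have "p * lam = 20000000 * Lam" using lam by (simp add: p_def)
          then have "(4 * p * (p * lam)) * (\<alpha> / 3200000) = 25 * p * Lam * \<alpha>" by simp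
          moreover have "(4 * p * (p * lam)) * N = 4 * p\<^sup>2 * lam * N" by (simp add: power2_eq_square)
          ultimately have "25 * p * Lam * \<alpha> \<le> 4 * p\<^sup>2 * lam * N" by (simp only:)
          moreover have "14 * (p * Lam * \<alpha>) < 25 * (p * Lam * \<alpha>)"
            using \<open>0 < p\<close> \<open>0 < Lam\<close> \<alpha>\<beta> by simp
          ultimately have "0 < L" using L by linarith
          then have "0 < K * E x * L" using \<open>0 < K\<close> E by simp
          moreover have "0 \<le> lam * (W11 x + (x$1)\<^sup>2 * W22 x)" using lam psd by simp
          ultimately show False using tr by simp
        qed
        have "0 \<le> N" by (simp add: N_def)
        \<comment> \<open>In the core the gradient term may vanish; dropping it no longer excludes
          contact but still bounds the trace.\<close>
        then have "- L \<le> 14 * p * Lam * \<alpha>"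
          using L lam by (smt (verit) mult_nonneg_nonneg zero_le_power2)
        then have "K * E x * (- L) \<le> K * E x * (14 * p * Lam * \<alpha>)"
          using \<open>0 < K\<close> E by (intro mult_left_mono) auto
        also have "\<dots> \<le> K * 1 * (14 * p * Lam * \<alpha>)"
          using \<open>0 < K\<close> E \<open>0 < p\<close> \<open>0 < Lam\<close> \<alpha>\<beta> by (intro mult_right_mono mult_left_mono) auto
        finally have "lam * (W11 x + (x$1)\<^sup>2 * W22 x) \<le> 14 * K * p * Lam * \<alpha>"
          using tr by (simp add: algebra_simps)
        then have sum_le: "W11 x + (x$1)\<^sup>2 * W22 x \<le> 14 * K * p * Lam / lam * \<alpha>"
          using lam by (simp add: field_simps)
        \<comment> \<open>This is at most half of \<alpha> c1^2, so the core cannot reach the axis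
          and W22 can be recovered from x1^2 W22.\<close>
        have "\<alpha> * (x$1 - c$1)\<^sup>2 \<le> 1/2000"
          using \<open>x \<in> B\<close> \<alpha>\<beta> by (simp add: B_def ellipse_def) (smt (verit) mult_nonneg_nonneg zero_le_power2)
        then have "\<alpha> * (x$1 - c$1)\<^sup>2 \<le> \<alpha> * (3/4 * c$1)\<^sup>2"
          using c by (simp add: power_mult_distrib power_divide)
        then have "\<bar>x$1 - c$1\<bar> \<le> \<bar>3/4 * c$1\<bar>"
          using \<alpha>\<beta> by (simp only: mult_le_cancel_left_pos abs_le_square_iff)
        then have "\<bar>c$1 / 4\<bar> \<le> \<bar>x$1\<bar>"
          by linarith
        then have "(c$1)\<^sup>2 / 16 \<le> (x$1)\<^sup>2" by (simp only: abs_le_square_iff power_divide) simp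
        then have "\<beta> * ((c$1)\<^sup>2 / 16) \<le> \<beta> * (x$1)\<^sup>2" using \<alpha>\<beta> by (intro mult_left_mono) auto
        then have "\<alpha> / 3200 \<le> \<beta> * (x$1)\<^sup>2" using c by simp
        then have "\<alpha> / 3200 * (W11 x * W22 x) \<le> \<beta> * (x$1)\<^sup>2 * (W11 x * W22 x)"
          using psd by (intro mult_right_mono) auto
        also have "\<dots> \<le> \<beta> * ((W11 x + (x$1)\<^sup>2 * W22 x)\<^sup>2 / 4)"
          using mult_left_mono[OF zero_le_power2[of "W11 x - (x$1)\<^sup>2 * W22 x"], of \<beta>] \<alpha>\<beta>
          by (simp add: power2_eq_square algebra_simps)
        also have "\<dots> \<le> \<beta> * ((14 * K * p * Lam / lam * \<alpha>)\<^sup>2 / 4)"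
          using \<alpha>\<beta> sum_le psd by (intro mult_left_mono divide_right_mono power_mono) auto
        also have "\<dots> = \<alpha> / 3200 * (J0 * \<alpha> * \<beta>)"
          by (simp add: J0_def power2_eq_square)
        finally have "W11 x * W22 x \<le> J0 * \<alpha> * \<beta>"
          using \<alpha>\<beta> by (simp only: mult_le_cancel_left_pos[of "\<alpha> / 3200"] divide_pos_pos zero_less_numeral)
        with \<open>x \<in> B\<close> show ?thesis by simp
      qed
    qed
    also have "\<dots> \<le> (J0 * \<alpha> * \<beta>) * measure lebesgue {x. ellipse \<alpha> \<beta> c x < 1/2000 \<and> u x \<le> K + 2}"
    proof (intro mult_left_mono measure_mono_fmeasurable)
      have W_cont: "continuous_on U W" "continuous_on U u"
        unfolding W_def E_def ellipse_def using u(1)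
        by (auto simp: numeral_2_eq_2 intro!: continuous_intros)
      have eq: "{x \<in> B. W x \<le> W x0 + 2 * (1/8)} = B \<inter> U \<inter> W -` {..W x0 + 2 * (1/8)}"
        "{x. ellipse \<alpha> \<beta> c x < 1/2000 \<and> u x \<le> K + 2} = B \<inter> U \<inter> u -` {..K + 2}"
        using \<open>B \<subseteq> D\<close> U by (auto simp: B_def D_def)
      show "{x \<in> B. W x \<le> W x0 + 2 * (1/8)} \<in> sets lebesgue"
        unfolding eq using \<open>B \<in> lmeasurable\<close> U(1) W_cont
        by (intro fmeasurableD fmeasurable_Int_vimage_closed) auto
      show "{x. ellipse \<alpha> \<beta> c x < 1/2000 \<and> u x \<le> K + 2} \<in> lmeasurable"
        unfolding eq using \<open>B \<in> lmeasurable\<close> U(1) W_cont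
        by (intro fmeasurable_Int_vimage_closed) auto
      show "{x \<in> B. W x \<le> W x0 + 2 * (1/8)} \<subseteq> {x. ellipse \<alpha> \<beta> c x < 1/2000 \<and> u x \<le> K + 2}"
      proof clarify
        fix x assume x: "x \<in> B" "W x \<le> W x0 + 2 * (1/8)"
        \<comment> \<open>These give u x \<le> K E x + u x0 - K E x0 + 1/4 \<le> K + 7/4.\<close>
        have "E x \<le> 1" "0 \<le> E x0"
          using ellipse_nonneg[of x] \<open>0 < p\<close> by (auto simp: E_def)
        then have "K * E x \<le> K" "0 \<le> K * E x0"
          using \<open>0 < K\<close> by (auto simp: mult_left_le)
        then show "ellipse \<alpha> \<beta> c x < 1/2000 \<and> u x \<le> K + 2"
          using x x0(2) by (simp add: B_def W_def)
      qed
      show "0 \<le> J0 * \<alpha> * \<beta>" using \<open>0 < J0\<close> \<alpha>\<beta> by simp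
    qed
    finally have le: "4 * \<delta>1 * \<delta>2 \<le> J0 * \<alpha> * \<beta> * m"
      unfolding m_def .
    define s where "s = sqrt (\<alpha> * \<beta>)"
    have "0 < s" "\<alpha> * \<beta> = s * s" using \<alpha>\<beta> by (auto simp: s_def)
    moreover have "4 * \<delta>1 * \<delta>2 = s * (1 / 64)"
      by (simp add: \<delta>1_def \<delta>2_def s_def real_sqrt_mult)
    moreover have "J0 * \<alpha> * \<beta> * m = J0 * (\<alpha> * \<beta>) * m"
      by simp
    ultimately have "s * (1 / 64) \<le> s * (J0 * s * m)"
      using le by (simp only: mult.assoc mult.left_commute)
    then have "1 / 64 \<le> J0 * s * m"
      using \<open>0 < s\<close> by (simp only: mult_le_cancel_left_pos)
    then have "1 / (64 * J0) / s \<le> m"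
      using \<open>0 < J0\<close> \<open>0 < s\<close> by (simp add: field_simps)
    then show "1 / (64 * J0) / sqrt (\<alpha> * \<beta>) \<le> measure lebesgue {x. ellipse \<alpha> \<beta> c x < 1/2000 \<and> u x \<le> K + 2}"
      by (simp only: s_def m_def)
  qed
qed

section \<open>Geometry of the quasi-balls\<close>

lemma abs_less_square_iff: "\<bar>x\<bar> < \<bar>y\<bar> \<longleftrightarrow> x\<^sup>2 < y\<^sup>2" for x y :: "'a::linordered_idom"
  by (simp add: abs_le_square_iff flip: not_le)

text \<open>The quasi-balls after the Grushin dilation, in the coordinates
  A = y1 / r, X = x1 / r, Y = (x2 - y2) / r^2.\<close>

definition normalized_G :: "real \<Rightarrow> real \<Rightarrow> real \<Rightarrow> real \<Rightarrow> bool" where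
  "normalized_G k A X Y \<longleftrightarrow> (if \<bar>A\<bar> < k then (X\<^sup>2 - A\<^sup>2)\<^sup>2 + 4 * Y\<^sup>2 < k ^ 4
     else 0 \<le> X * A \<and> (X\<^sup>2 - A\<^sup>2)\<^sup>2 + 4 * Y\<^sup>2 < (k * A)\<^sup>2)"

text \<open>\<open>rho\<close> is homogeneous of degree 1 under (x1, x2) \<mapsto> (r x1, r^2 x2)
  about the axis, so only A = y1 / r survives. Roots and the infinite value disappear as well:
  membership becomes a polynomial inequality with a sign condition.\<close>

lemma mem_G_iff:
  assumes "0 < r" "0 < k"
  shows "x \<in> G y (k * r) \<longleftrightarrow> normalized_G k (y$1 / r) (x$1 / r) ((x$2 - y$2) / r\<^sup>2)"
proof -
  define A X Y where "A = y$1 / r" and "X = x$1 / r" and "Y = (x$2 - y$2) / r\<^sup>2"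
  define n where "n = (X\<^sup>2 - A\<^sup>2)\<^sup>2 + 4 * Y\<^sup>2"
  have xy: "y$1 = r * A" "x$1 = r * X" "x$2 - y$2 = r\<^sup>2 * Y"
    using assms by (auto simp: A_def X_def Y_def)
  have "0 \<le> n" by (simp add: n_def)
  have "((x$1)\<^sup>2 - (y$1)\<^sup>2)\<^sup>2 + 4 * (x$2 - y$2)\<^sup>2 = r ^ 4 * n"
    unfolding xy n_def by (simp add: power2_eq_square power4_eq_xxxx algebra_simps)
  then have rho: "rho x y = r * root 4 n"
    using assms by (simp add: rho_def real_root_mult real_root_power_cancel)
  have root2: "(root 4 n)\<^sup>2 = sqrt n"
    using \<open>0 \<le> n\<close> by (intro real_sqrt_unique[symmetric]) (auto simp: real_root_pow_pos2 simp flip: power_mult)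
  have "root 4 n < k \<longleftrightarrow> root 4 n < root 4 (k ^ 4)"
    using assms by (simp add: real_root_power_cancel)
  then have 1: "root 4 n < k \<longleftrightarrow> n < k ^ 4" by simp
  have "sqrt n < k * \<bar>A\<bar> \<longleftrightarrow> sqrt n < sqrt ((k * A)\<^sup>2)"
    using assms by (simp add: abs_mult)
  then have 2: "sqrt n < k * \<bar>A\<bar> \<longleftrightarrow> n < (k * A)\<^sup>2" by (simp only: real_sqrt_less_iff)
  have 3: "(rho x y)\<^sup>2 / \<bar>y$1\<bar> < k * r \<longleftrightarrow> sqrt n < k * \<bar>A\<bar>" if "k \<le> \<bar>A\<bar>"
  proof -
    have "0 < \<bar>A\<bar>" using that assms by linarith
    have "(rho x y)\<^sup>2 / \<bar>y$1\<bar> = r * (sqrt n / \<bar>A\<bar>)"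
      using assms by (simp add: rho xy power_mult_distrib root2 abs_mult power2_eq_square[of r])
    then show ?thesis
      using assms \<open>0 < \<bar>A\<bar>\<close> by (simp add: mult.commute[of k r] pos_divide_less_eq)
  qed
  have "\<bar>y$1\<bar> < k * r \<longleftrightarrow> \<bar>A\<bar> < k"
    using assms by (simp add: xy abs_mult mult.commute)
  moreover have "0 \<le> x$1 * y$1 \<longleftrightarrow> 0 \<le> X * A"
  proof -
    have "x$1 * y$1 = r\<^sup>2 * (X * A)" by (simp add: xy power2_eq_square)
    then show ?thesis using assms by (simp add: zero_le_mult_iff)
  qed
  moreover have "rho x y < k * r \<longleftrightarrow> root 4 n < k"
    using assms by (simp add: rho mult.commute)
  ultimately show ?thesis
    using 1 2 3
    by (auto simp: G_def g_def normalized_G_def n_def A_def X_def Y_def)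
qed

text \<open>The branch can change only from the second to the first, when k \<le> |A| < l. The sign
  condition is then dropped, and (k A)^2 \<le> l^4 gives the inequality.\<close>

lemma normalized_G_mono:
  assumes "normalized_G k A X Y" "0 < k" "k \<le> l"
  shows "normalized_G l A X Y"
proof -
  have "(k * A)\<^sup>2 \<le> (l * A)\<^sup>2"
    using assms by (simp add: power_mult_distrib mult_right_mono power_mono)
  moreover have "k ^ 4 \<le> l ^ 4"
    using assms by (intro power_mono) auto
  moreover have "(k * A)\<^sup>2 \<le> l ^ 4" if "\<bar>A\<bar> < l"
  proof -
    have "(k * \<bar>A\<bar>)\<^sup>2 \<le> (l * l)\<^sup>2"
      using assms that by (intro power_mono mult_mono) auto
    then show ?thesis by (simp add: power2_eq_square power4_eq_xxxx algebra_simps)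
  qed
  ultimately show ?thesis
    using assms unfolding normalized_G_def by (smt (verit))
qed

lemma G_mono: "0 < r \<Longrightarrow> 0 < k \<Longrightarrow> k \<le> l \<Longrightarrow> G y (k * r) \<subseteq> G y (l * r)"
  by (auto simp: mem_G_iff intro: normalized_G_mono)

text \<open>Used for the upper bound on the area. In the second branch the sign condition gives |A|
  \<le> |X + A|, so |X - A| is controlled by |X^2 - A^2| / |A|.\<close>

lemma normalized_G_box:
  assumes "normalized_G (3/2) A X Y"
  shows "\<bar>X - A\<bar> \<le> 4 \<and> \<bar>Y\<bar> \<le> 9/8 * max 1 \<bar>A\<bar>"
proof (cases "\<bar>A\<bar> < 3/2")
  case True
  then have n: "(X\<^sup>2 - A\<^sup>2)\<^sup>2 + 4 * Y\<^sup>2 < (9/4)\<^sup>2"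
    using assms by (simp add: normalized_G_def power_divide)
  have "4 * Y\<^sup>2 < (9/4)\<^sup>2" "(X\<^sup>2 - A\<^sup>2)\<^sup>2 < (9/4)\<^sup>2"
    using n zero_le_power2[of Y] zero_le_power2[of "X\<^sup>2 - A\<^sup>2"] by linarith+
  then have "\<bar>2 * Y\<bar> < \<bar>9/4\<bar>" "\<bar>X\<^sup>2 - A\<^sup>2\<bar> < \<bar>9/4\<bar>"
    unfolding abs_less_square_iff power_mult_distrib by simp_all
  then have Y: "2 * \<bar>Y\<bar> < 9/4" and "\<bar>X\<^sup>2 - A\<^sup>2\<bar> < 9/4"
    by simp_all
  moreover have "A\<^sup>2 \<le> (3/2)\<^sup>2"
    using True by (intro abs_le_square_iff[THEN iffD1]) auto
  ultimately have "X\<^sup>2 \<le> (5/2)\<^sup>2" by (simp add: power_divide; linarith)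
  then have "\<bar>X\<bar> \<le> 5/2" by (simp add: abs_le_square_iff[symmetric])
  then show ?thesis using True Y by linarith
next
  case False
  then have n: "0 \<le> X * A" "(X\<^sup>2 - A\<^sup>2)\<^sup>2 + 4 * Y\<^sup>2 < (3/2 * A)\<^sup>2"
    using assms by (auto simp: normalized_G_def)
  have "4 * Y\<^sup>2 < (3/2 * A)\<^sup>2" "(X\<^sup>2 - A\<^sup>2)\<^sup>2 < (3/2 * A)\<^sup>2"
    using n(2) zero_le_power2[of Y] zero_le_power2[of "X\<^sup>2 - A\<^sup>2"] by linarith+
  then have "\<bar>2 * Y\<bar> < \<bar>3/2 * A\<bar>" and XA: "\<bar>X\<^sup>2 - A\<^sup>2\<bar> < \<bar>3/2 * A\<bar>"
    unfolding abs_less_square_iff power_mult_distrib[of 2] by simp_all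
  moreover have "\<bar>X - A\<bar> < 3/2"
  proof -
    have "\<bar>A\<bar> \<le> \<bar>X + A\<bar>"
      using n(1) by (auto simp: zero_le_mult_iff)
    then have "\<bar>X - A\<bar> * \<bar>A\<bar> \<le> \<bar>X - A\<bar> * \<bar>X + A\<bar>"
      by (intro mult_left_mono) auto
    also have "\<dots> = \<bar>X\<^sup>2 - A\<^sup>2\<bar>"
      by (simp add: power2_eq_square algebra_simps flip: abs_mult)
    also have "\<dots> < 3/2 * \<bar>A\<bar>" using XA by simp
    finally show ?thesis by (rule mult_right_less_imp_less) simp
  qed
  ultimately show ?thesis by (auto simp: max_def)
qed

text \<open>Up to the shift by 1/16, Q \<le> 1 reads X^2 + 3/2 Y^2 \<le> 7/2. The weights leave room
  on both sides, for every |A| < 5/4, to absorb the linear term caused by the shift.\<close>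

lemma near_axis_ellipse:
  fixes A X Y :: real
  assumes A: "\<bar>A\<bar> < 5/4"
  defines "Q \<equiv> 2/7 * (X - 1/16)\<^sup>2 + 3/7 * Y\<^sup>2"
  shows "normalized_G 1 A X Y \<Longrightarrow> Q \<le> 9/10"
    and "Q \<le> 1 \<Longrightarrow> X\<^sup>2 \<le> 4"
    and "Q \<le> 1 \<Longrightarrow> normalized_G 2 A X Y"
    and "Q < 1/2000 \<Longrightarrow> normalized_G (3/2) A X Y"
proof -
  define a where "a = A\<^sup>2"
  have "A\<^sup>2 < (5/4)\<^sup>2" using A by (intro abs_less_square_iff[THEN iffD1]) auto
  then have a: "0 \<le> a" "a < 25/16" by (auto simp: a_def power_divide)
  show "Q \<le> 9/10" if "normalized_G 1 A X Y"
  proof -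
    have n: "(X\<^sup>2 - a)\<^sup>2 + 4 * Y\<^sup>2 < 25/16"
      using that a by (auto simp: normalized_G_def a_def split: if_splits)
    \<comment> \<open>With z = X^2 - a this square says z \<le> 3/8 z^2 + 2/3; the factor 3/8 turns
      4 Y^2 into the 3/2 Y^2 of the ellipse.\<close>
    have "0 \<le> (X\<^sup>2 - a - 4/3)\<^sup>2" by simp
    then have "X\<^sup>2 + 3/2 * Y\<^sup>2 \<le> a + 3/8 * 25/16 + 2/3"
      using n by (simp add: power2_eq_square algebra_simps)
    then have *: "X\<^sup>2 + 3/2 * Y\<^sup>2 \<le> (141/50)" using a by simp
    then have "X\<^sup>2 \<le> (17/10)\<^sup>2" using zero_le_power2[of Y] unfolding power2_eq_square by linarith
    then have "\<bar>X\<bar> \<le> (17/10)" by (simp add: abs_le_square_iff[symmetric])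
    then have "(X - 1/16)\<^sup>2 \<le> X\<^sup>2 + (11/50)" by (simp add: power2_eq_square algebra_simps abs_le_iff)
    then show ?thesis using * by (simp add: Q_def)
  qed
  have Q1: "X\<^sup>2 + 3/2 * Y\<^sup>2 \<le> (15/4) \<and> X\<^sup>2 \<le> 4" if "Q \<le> 1"
  proof -
    have "(X - 1/16)\<^sup>2 + 3/2 * Y\<^sup>2 \<le> (7/2)" using that by (simp add: Q_def)
    moreover from this have "(X - 1/16)\<^sup>2 \<le> 225/64"
      using zero_le_power2[of Y] by linarith
    then have "(X - 1/16)\<^sup>2 \<le> (15/8)\<^sup>2"
      by (simp add: power_divide)
    then have "\<bar>X - 1/16\<bar> \<le> (15/8)" by (simp add: abs_le_square_iff[symmetric])
    ultimately show ?thesis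
      using zero_le_power2[of Y] unfolding power2_eq_square abs_le_iff
      by (intro conjI; simp add: algebra_simps; linarith)
  qed
  show "X\<^sup>2 \<le> 4" if "Q \<le> 1" using Q1[OF that] by simp
  show "normalized_G 2 A X Y" if "Q \<le> 1"
  proof -
    note q = Q1[OF that]
    have "X\<^sup>2 * (X\<^sup>2 - (15/4)) \<le> 0" using q zero_le_power2[of Y]
      by (intro mult_nonneg_nonpos zero_le_power2) linarith
    \<comment> \<open>Replacing X^4 by 15/4 X^2 and Y^2 by its bound leaves an expression affine in
      X^2; the sign of its coefficient 13/12 - 2 a decides the next case split.\<close>
    then have "(X\<^sup>2 - a)\<^sup>2 + 4 * Y\<^sup>2 \<le> (15/4) * X\<^sup>2 - 2 * a * X\<^sup>2 + a\<^sup>2 + 8/3 * ((15/4) - X\<^sup>2)"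
      using q by (simp add: power2_eq_square algebra_simps)
    also have "\<dots> < 16"
    proof -
      have "X\<^sup>2 * (13/12 - 2 * a) + a\<^sup>2 < 6"
      proof (cases "13/12 \<le> 2 * a")
        case True
        then have "X\<^sup>2 * (13/12 - 2 * a) \<le> 0" by (intro mult_nonneg_nonpos) auto
        moreover have "a\<^sup>2 \<le> (25/16)\<^sup>2" using a by (intro power_mono) auto
        ultimately show ?thesis by (simp add: power_divide)
      next
        case False
        then have "X\<^sup>2 * (13/12 - 2 * a) \<le> 4 * (13/12)" using q a by (intro mult_mono) auto
        moreover have "a\<^sup>2 \<le> 1\<^sup>2" using a False by (intro power_mono) auto
        ultimately show ?thesis by simp
      qed
      then show ?thesis by (simp add: algebra_simps)
    qed
    finally show ?thesis using A by (simp add: normalized_G_def a_def)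
  qed
  show "normalized_G (3/2) A X Y" if "Q < 1/2000"
  proof -
    have Y: "Y\<^sup>2 \<le> 1/100" and "(X - 1/16)\<^sup>2 \<le> 1/100"
      using that zero_le_power2[of Y] zero_le_power2[of "X - 1/16"] unfolding Q_def by linarith+
    then have "(X - 1/16)\<^sup>2 \<le> (1/10)\<^sup>2" by (simp add: power_divide)
    then have "\<bar>X - 1/16\<bar> \<le> \<bar>1/10\<bar>" by (simp only: abs_le_square_iff)
    then have "\<bar>X\<bar> \<le> 1/4" by linarith
    then have "X\<^sup>2 \<le> (1/4)\<^sup>2" by (intro abs_le_square_iff[THEN iffD1]) auto
    then have "X\<^sup>2 \<le> 1/16" by (simp add: power_divide)
    then have "\<bar>X\<^sup>2 - a\<bar> \<le> \<bar>2\<bar>" using a zero_le_power2[of X] by linarith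
    then have "(X\<^sup>2 - a)\<^sup>2 \<le> 2\<^sup>2" by (simp only: abs_le_square_iff)
    then show ?thesis using Y A by (simp add: normalized_G_def a_def power_divide)
  qed
qed

text \<open>With X = A (1 + w), Y = A Z and e = A^2 w^2, the second branch reads e (2 + w)^2 + 4 Z^2
  < k^2. The ellipse comes from replacing 2 + w by 2, and |A| \<ge> 5/4 keeps w small enough for the
  error to fit.\<close>

lemma far_from_axis_ellipse:
  fixes A X Y :: real
  assumes A: "5/4 \<le> \<bar>A\<bar>"
  defines "Q \<equiv> 25/16 * (X - A)\<^sup>2 + 25/16 / A\<^sup>2 * Y\<^sup>2"
  shows "normalized_G 1 A X Y \<Longrightarrow> Q \<le> 9/10"
    and "Q \<le> 1 \<Longrightarrow> X\<^sup>2 \<le> 6 * A\<^sup>2"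
    and "Q \<le> 1 \<Longrightarrow> normalized_G 2 A X Y"
    and "Q < 1/2000 \<Longrightarrow> normalized_G (3/2) A X Y"
proof -
  define b where "b = A\<^sup>2"
  define w where "w = X / A - 1"
  define Z where "Z = Y / A"
  have "A \<noteq> 0" using A by auto
  then have X: "X = A * (1 + w)" and Y: "Y = A * Z" by (auto simp: w_def Z_def)
  have "(5/4)\<^sup>2 \<le> A\<^sup>2" using A by (intro abs_le_square_iff[THEN iffD1]) auto
  then have b: "25/16 \<le> b" by (simp add: b_def power_divide)
  have Q: "Q = 25/16 * (b * w\<^sup>2 + Z\<^sup>2)"
    using \<open>A \<noteq> 0\<close> by (simp add: Q_def X Y b_def power2_eq_square field_simps)
  have n: "(X\<^sup>2 - A\<^sup>2)\<^sup>2 + 4 * Y\<^sup>2 = b * (b * w\<^sup>2 * (2 + w)\<^sup>2 + 4 * Z\<^sup>2)"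
    by (simp add: X Y b_def power2_eq_square algebra_simps)
  have XA: "0 \<le> X * A \<longleftrightarrow> -1 \<le> w"
  proof -
    have "X * A = b * (1 + w)" by (simp add: X b_def power2_eq_square)
    then show ?thesis using b by (auto simp: zero_le_mult_iff)
  qed
  have G: "normalized_G k A X Y \<longleftrightarrow> (if \<bar>A\<bar> < k then b * (b * w\<^sup>2 * (2 + w)\<^sup>2 + 4 * Z\<^sup>2) < k ^ 4
      else -1 \<le> w \<and> b * w\<^sup>2 * (2 + w)\<^sup>2 + 4 * Z\<^sup>2 < k\<^sup>2)" for k
  proof -
    have "b * (b * w\<^sup>2 * (2 + w)\<^sup>2 + 4 * Z\<^sup>2) < (k * A)\<^sup>2 \<longleftrightarrow> b * w\<^sup>2 * (2 + w)\<^sup>2 + 4 * Z\<^sup>2 < k\<^sup>2"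
      using b by (simp add: power_mult_distrib b_def[symmetric] mult.commute[of "k\<^sup>2"])
    then show ?thesis by (simp add: normalized_G_def n XA)
  qed
  define e where "e = b * w\<^sup>2"
  have "0 \<le> e" using b by (simp add: e_def)
  have w_le: "25/16 * w\<^sup>2 \<le> e" unfolding e_def using b by (intro mult_right_mono) auto
  show "Q \<le> 9/10" if "normalized_G 1 A X Y"
  proof -
    have w: "-1 \<le> w" and h: "e * (2 + w)\<^sup>2 + 4 * Z\<^sup>2 < 1"
      using that A by (auto simp: G e_def split: if_splits)
    have "e + Z\<^sup>2 \<le> 72/125"
    proof (cases "0 \<le> w")
      case True
      then have "2\<^sup>2 \<le> (2 + w)\<^sup>2" by (intro power_mono) auto
      then have "e * 4 \<le> e * (2 + w)\<^sup>2" using \<open>0 \<le> e\<close> by (intro mult_left_mono) auto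
      then show ?thesis using h by simp
    next
      case False
      \<comment> \<open>Towards the axis the factor 2 + w falls below 2, so \<open>e\<close> may
        exceed 1/4. The bound v < 14/25 keeps the loss e v (4 - v) below 28/25.\<close>
      define v where "v = - w"
      have v: "0 < v" "v \<le> 1" "w = - v" using w False by (auto simp: v_def)
      have "25/16 * (v * (2 - v))\<^sup>2 = 25/16 * w\<^sup>2 * (2 + w)\<^sup>2"
        by (simp add: v power_mult_distrib)
      also have "\<dots> \<le> e * (2 + w)\<^sup>2"
        using w_le by (intro mult_right_mono) auto
      finally have "(v * (2 - v))\<^sup>2 < (4/5)\<^sup>2"
        using h zero_le_power2[of Z] unfolding power_divide by (simp; linarith)
      then have "v * (2 - v) < 4/5" by (rule power2_less_imp_less) simp
      then have "(11/25)\<^sup>2 < (1 - v)\<^sup>2" by (simp add: power2_eq_square algebra_simps)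
      then have "(11/25) < 1 - v" by (rule power2_less_imp_less) (use v in simp)
      then have v': "v < (14/25)" by simp
      then have "(36/25)\<^sup>2 \<le> (2 - v)\<^sup>2" by (intro power_mono) auto
      then have "e * (36/25)\<^sup>2 \<le> e * (2 + w)\<^sup>2" using \<open>0 \<le> e\<close> v by (intro mult_left_mono) auto
      then have "e < 1/2" using h zero_le_power2[of Z] unfolding power_divide by (simp; linarith)
      have "v * (4 - v) \<le> (14/25) * 4" using v v' by (intro mult_mono) auto
      then have "e * (v * (4 - v)) \<le> 1/2 * ((14/25) * 4)"
        by (rule mult_mono[OF less_imp_le[OF \<open>e < 1/2\<close>]]) (use v in auto)
      moreover have "4 * (e + Z\<^sup>2) = e * (2 + w)\<^sup>2 + 4 * Z\<^sup>2 + e * (v * (4 - v))"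
        by (simp add: v power2_eq_square algebra_simps)
      ultimately show ?thesis using h by simp
    qed
    then show ?thesis by (simp add: Q e_def)
  qed
  have w4: "\<bar>w\<bar> \<le> (16/25)" if "Q \<le> 1"
  proof -
    have "e + Z\<^sup>2 \<le> 16/25" using that by (simp add: Q e_def)
    then have "w\<^sup>2 \<le> (16/25)\<^sup>2" using w_le zero_le_power2[of Z] unfolding power2_eq_square by linarith
    then show ?thesis by (simp add: abs_le_square_iff[symmetric])
  qed
  show "X\<^sup>2 \<le> 6 * A\<^sup>2" if "Q \<le> 1"
  proof -
    have "(1 + w)\<^sup>2 \<le> 2\<^sup>2" using w4[OF that] by (intro power_mono) auto
    then have "A\<^sup>2 * (1 + w)\<^sup>2 \<le> A\<^sup>2 * 6" by (intro mult_left_mono) auto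
    then show ?thesis by (simp add: X power_mult_distrib)
  qed
  show "normalized_G 2 A X Y" if "Q \<le> 1"
  proof (cases "\<bar>A\<bar> < 2")
    case True
    then have "A\<^sup>2 < 2\<^sup>2" by (intro abs_less_square_iff[THEN iffD1]) auto
    then have "b < 4" by (simp add: b_def)
    have eZ: "e + Z\<^sup>2 \<le> 16/25" using that by (simp add: Q e_def)
    then have "e \<le> 16/25" by (smt (verit) zero_le_power2)
    \<comment> \<open>The bound |w| \<le> 16/25 alone would be too weak for the target 16; w is
      controlled jointly with b through (b w)^2 = b e.\<close>
    have "(b * w)\<^sup>2 = b * e" by (simp add: e_def power2_eq_square)
    also have "\<dots> \<le> 4 * (16/25)" using \<open>b < 4\<close> \<open>e \<le> 16/25\<close> \<open>0 \<le> e\<close> b by (intro mult_mono) auto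
    finally have "(b * w)\<^sup>2 \<le> (8/5)\<^sup>2" by (simp add: power_divide)
    then have "b * w \<le> 8/5" by (rule power2_le_imp_le) simp
    then have "b * (2 + w)\<^sup>2 \<le> (576/25)"
      using \<open>b < 4\<close> \<open>e \<le> 16/25\<close> by (simp add: e_def power2_eq_square algebra_simps)
    then have "(b * (2 + w)\<^sup>2) * e \<le> (576/25) * e" using \<open>0 \<le> e\<close> by (intro mult_right_mono)
    moreover have "b * (4 * Z\<^sup>2) \<le> 4 * (4 * Z\<^sup>2)" using \<open>b < 4\<close> by (intro mult_right_mono) auto
    ultimately have "(b * (2 + w)\<^sup>2) * e + b * (4 * Z\<^sup>2) < 16"
      using eZ zero_le_power2[of Z] by linarith
    then show ?thesis using True by (simp add: G e_def algebra_simps)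
  next
    case False
    then have "2\<^sup>2 \<le> A\<^sup>2" by (intro abs_le_square_iff[THEN iffD1]) auto
    then have "4 * w\<^sup>2 \<le> e" unfolding e_def by (intro mult_right_mono) (auto simp: b_def)
    moreover have eZ: "e + Z\<^sup>2 \<le> 16/25" using that by (simp add: Q e_def)
    ultimately have "w\<^sup>2 \<le> (2/5)\<^sup>2" using zero_le_power2[of Z] unfolding power2_eq_square by linarith
    then have "\<bar>w\<bar> \<le> 2/5" by (simp add: abs_le_square_iff[symmetric])
    then have "(2 + w)\<^sup>2 \<le> (12/5)\<^sup>2" by (intro power_mono) auto
    then have "e * (2 + w)\<^sup>2 \<le> e * (12/5)\<^sup>2" using \<open>0 \<le> e\<close> by (intro mult_left_mono)
    then have "e * (2 + w)\<^sup>2 + 4 * Z\<^sup>2 < 4" using eZ zero_le_power2[of Z] by (simp add: power_divide; linarith)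
    then show ?thesis using False \<open>\<bar>w\<bar> \<le> 2/5\<close> by (simp add: G e_def)
  qed
  show "normalized_G (3/2) A X Y" if "Q < 1/2000"
  proof -
    have eZ: "e + Z\<^sup>2 < 1/3125" using that by (simp add: Q e_def)
    have w: "\<bar>w\<bar> \<le> (16/25)" using w4 that by simp
    then have "(2 + w)\<^sup>2 \<le> 3\<^sup>2" by (intro power_mono) auto
    then have "e * (2 + w)\<^sup>2 \<le> e * 3\<^sup>2" using \<open>0 \<le> e\<close> by (intro mult_left_mono)
    then have m: "e * (2 + w)\<^sup>2 + 4 * Z\<^sup>2 < 1/100" using eZ zero_le_power2[of Z] by (simp; linarith)
    have "b * (e * (2 + w)\<^sup>2 + 4 * Z\<^sup>2) < 81/16" if "\<bar>A\<bar> < 3/2"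
    proof -
      have "A\<^sup>2 < (3/2)\<^sup>2" using that by (intro abs_less_square_iff[THEN iffD1]) auto
      then have "b * (e * (2 + w)\<^sup>2 + 4 * Z\<^sup>2) \<le> (3/2)\<^sup>2 * (1/100)"
        using m \<open>0 \<le> e\<close> by (intro mult_mono) (auto simp: b_def)
      then show ?thesis by (simp add: power_divide)
    qed
    then show ?thesis using m w by (auto simp: G e_def power_divide)
  qed
qed

text \<open>The sign condition in the second branch is not strict, but equality never occurs: at x1
  = 0 the quartic expression is at least A^4 \<ge> A^2.\<close>

lemma open_G:
  assumes "0 < r"
  shows "open (G y r)"
proof -
  define A where "A = y$1 / r"
  define n where "n x = ((x$1 / r)\<^sup>2 - A\<^sup>2)\<^sup>2 + 4 * ((x$2 - y$2) / r\<^sup>2)\<^sup>2" for x :: "real^2"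
  have n_cont: "continuous_on UNIV n"
    unfolding n_def using assms by (intro continuous_intros) auto
  have mem: "x \<in> G y r \<longleftrightarrow> (if \<bar>A\<bar> < 1 then n x < 1 else 0 \<le> x$1 / r * A \<and> n x < A\<^sup>2)" for x
    using mem_G_iff[OF assms zero_less_one, of x y] by (simp add: normalized_G_def n_def A_def)
  show ?thesis
  proof (cases "\<bar>A\<bar> < 1")
    case True
    then have "G y r = {x. n x < 1}" using mem by auto
    then show ?thesis using n_cont by (simp add: open_Collect_less)
  next
    case False
    have "0 < x$1 / r * A" if x: "0 \<le> x$1 / r * A" "n x < A\<^sup>2" for x
    proof (rule ccontr)
      assume "\<not> 0 < x$1 / r * A"
      then have "x$1 = 0" using x False assms by auto
      have "1 \<le> A\<^sup>2" using False by (simp add: abs_square_le_1 not_less) (metis abs_le_square_iff abs_one one_power2)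
      then have "A\<^sup>2 \<le> A\<^sup>2 * A\<^sup>2" using mult_right_mono[of 1 "A\<^sup>2" "A\<^sup>2"] by simp
      also have "\<dots> \<le> n x" by (simp add: n_def \<open>x$1 = 0\<close> power2_eq_square)
      finally show False using x by simp
    qed
    then have "G y r = {x. 0 < x$1 / r * A} \<inter> {x. n x < A\<^sup>2}"
      using mem False by (auto intro: less_imp_le)
    then show ?thesis
      using n_cont assms by (auto intro!: open_Int open_Collect_less continuous_intros)
  qed
qed

text \<open>An upper bound suffices, since the lower bound for the sublevel set comes from the core.
  The enclosing box has sides 8 r and 9/4 r^2 max 1 |A|.\<close>

lemma measure_G_le:
  assumes "0 < r"
  shows "measure lebesgue (G y (3 / 2 * r)) \<le> 18 * (r ^ 3 * max 1 \<bar>y$1 / r\<bar>)"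
    and "G y (3 / 2 * r) \<in> lmeasurable"
proof -
  define m where "m = max 1 \<bar>y$1 / r\<bar>"
  have "1 \<le> m" by (simp add: m_def)
  define h where "h = 9/8 * m * r\<^sup>2"
  have "0 \<le> h" using \<open>1 \<le> m\<close> by (simp add: h_def)
  define R where "R = cbox (vector [y$1 - 4 * r, y$2 - h]) (vector [y$1 + 4 * r, y$2 + h] :: real^2)"
  have sub: "G y (3 / 2 * r) \<subseteq> R"
  proof
    fix x assume "x \<in> G y (3 / 2 * r)"
    then have "normalized_G (3/2) (y$1 / r) (x$1 / r) ((x$2 - y$2) / r\<^sup>2)"
      using mem_G_iff[OF assms, of "3/2" x y] by simp
    from normalized_G_box[OF this] have "\<bar>(x$1 - y$1) / r\<bar> \<le> 4" "\<bar>(x$2 - y$2) / r\<^sup>2\<bar> \<le> 9/8 * m"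
      by (auto simp: m_def diff_divide_distrib)
    then have "\<bar>x$1 - y$1\<bar> \<le> 4 * r" "\<bar>x$2 - y$2\<bar> \<le> h"
      using assms by (simp_all add: h_def pos_divide_le_eq)
    then show "x \<in> R" by (auto simp: R_def mem_box_cart forall_2 abs_le_iff)
  qed
  have "y \<in> R" using \<open>0 \<le> h\<close> assms by (simp add: R_def mem_box_cart forall_2)
  then have "measure lebesgue R = 8 * r * (2 * h)"
    by (auto simp: R_def content_cbox_if_cart UNIV_2)
  also have "\<dots> = 18 * (r ^ 3 * m)"
    by (simp add: h_def power2_eq_square power3_eq_cube)
  finally have R: "measure lebesgue R = 18 * (r ^ 3 * m)" .
  have "open (G y (3 / 2 * r))" using assms by (intro open_G) auto
  then show G: "G y (3 / 2 * r) \<in> lmeasurable"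
    using sub bounded_subset[OF bounded_cbox] unfolding R_def by (intro lmeasurable_open) blast
  have "measure lebesgue (G y (3 / 2 * r)) \<le> measure lebesgue R"
    using sub G by (intro measure_mono_fmeasurable) (auto simp: R_def fmeasurableD)
  then show "measure lebesgue (G y (3 / 2 * r)) \<le> 18 * (r ^ 3 * max 1 \<bar>y$1 / r\<bar>)"
    using R by (simp add: m_def)
qed

lemma ellipse_between_G:
  fixes y :: "real^2"
  assumes r: "0 < r"
  obtains \<alpha> \<beta> c where "0 < \<alpha>" "0 < \<beta>" "1/1000 \<le> \<alpha> * (c$1)\<^sup>2" "\<alpha> / 200 \<le> \<beta> * (c$1)\<^sup>2"
    "\<And>x. ellipse \<alpha> \<beta> c x \<le> 1 \<Longrightarrow> \<beta> * (x$1)\<^sup>2 \<le> 6 * \<alpha>"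
    "\<And>x. x \<in> G y r \<Longrightarrow> ellipse \<alpha> \<beta> c x \<le> 9/10"
    "{x. ellipse \<alpha> \<beta> c x \<le> 1} \<subseteq> G y (2 * r)"
    "{x. ellipse \<alpha> \<beta> c x < 1/2000} \<subseteq> G y (3 / 2 * r)"
    "16/25 * (r ^ 3 * max 1 \<bar>y$1 / r\<bar>) \<le> 1 / sqrt (\<alpha> * \<beta>)"
proof -
  define A where "A = y$1 / r"
  define X Y where "X x = x$1 / r" and "Y x = (x$2 - y$2) / r\<^sup>2" for x :: "real^2"
  have G: "x \<in> G y r \<longleftrightarrow> normalized_G 1 A (X x) (Y x)"
    "x \<in> G y (2 * r) \<longleftrightarrow> normalized_G 2 A (X x) (Y x)"
    "x \<in> G y (3 / 2 * r) \<longleftrightarrow> normalized_G (3/2) A (X x) (Y x)" for x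
    using mem_G_iff[OF r, of 1 x y] mem_G_iff[OF r, of 2 x y] mem_G_iff[OF r, of "3/2" x y]
    by (auto simp: A_def X_def Y_def)
  \<comment> \<open>The threshold lies between 1 and 3/2: below it the two larger quasi-balls are in
    the first branch of \<open>normalized_G\<close>, from it on the smallest is in the
    second.\<close>
  show thesis
  proof (cases "\<bar>A\<bar> < 5/4")
    case True
    \<comment> \<open>The centre is moved off the axis by r/16, so that the horizontal gradient of the ellipse function vanishes only at the centre.\<close>
    define \<alpha> \<beta> and c :: "real^2" where "\<alpha> = 2/7 / r\<^sup>2" and "\<beta> = 3/7 / r ^ 4" and "c = vector [r / 16, y$2]"
    have Q: "ellipse \<alpha> \<beta> c x = 2/7 * (X x - 1/16)\<^sup>2 + 3/7 * (Y x)\<^sup>2" for x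
    proof -
      have "\<alpha> * (x$1 - c$1)\<^sup>2 = 2/7 * ((x$1 - c$1) / r)\<^sup>2" by (simp add: \<alpha>_def power_divide)
      moreover have "(x$1 - c$1) / r = X x - 1/16" using r by (simp add: c_def X_def diff_divide_distrib)
      moreover have "\<beta> * (x$2 - c$2)\<^sup>2 = 3/7 * (Y x)\<^sup>2"
        by (simp add: \<beta>_def c_def Y_def power_divide flip: power_mult)
      ultimately show ?thesis by (simp add: ellipse_def)
    qed
    note E = near_axis_ellipse[OF True]
    show thesis
    proof (rule that[of \<alpha> \<beta> c])
      show "0 < \<alpha>" "0 < \<beta>" using r by (auto simp: \<alpha>_def \<beta>_def)
      \<comment> \<open>Here \<alpha> c1^2 = 1/896 and \<beta> c1^2 / \<alpha> = 3/512; together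
        with 3/7 * 4 = 6 * 2/7 in the next bound, this case dictates 1/1000, 1/200 and 6.\<close>
      show "1/1000 \<le> \<alpha> * (c$1)\<^sup>2" "\<alpha> / 200 \<le> \<beta> * (c$1)\<^sup>2"
        using r by (auto simp: \<alpha>_def \<beta>_def c_def power2_eq_square power4_eq_xxxx field_simps)
      show "\<beta> * (x$1)\<^sup>2 \<le> 6 * \<alpha>" if "ellipse \<alpha> \<beta> c x \<le> 1" for x
      proof -
        have "\<beta> * (x$1)\<^sup>2 = 3/7 / r\<^sup>2 * (X x)\<^sup>2"
          using r by (simp add: \<beta>_def X_def power_divide power2_eq_square power4_eq_xxxx)
        also have "\<dots> \<le> 3/7 / r\<^sup>2 * 4"
          using E(2) that Q by (intro mult_left_mono) auto
        finally show ?thesis by (simp add: \<alpha>_def)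
      qed
      show "16/25 * (r ^ 3 * max 1 \<bar>y$1 / r\<bar>) \<le> 1 / sqrt (\<alpha> * \<beta>)"
      proof -
        have "\<alpha> * \<beta> = 6/49 / r ^ 6" "(5/4 / r ^ 3)\<^sup>2 = 25/16 / r ^ 6"
          by (simp_all add: \<alpha>_def \<beta>_def power_divide flip: power_mult power_add)
        moreover have "6/49 / r ^ 6 \<le> 25/16 / r ^ 6"
          using r by (intro divide_right_mono) auto
        ultimately have "\<alpha> * \<beta> \<le> (5/4 / r ^ 3)\<^sup>2" by simp
        then have "sqrt (\<alpha> * \<beta>) \<le> 5/4 / r ^ 3"
          using r by (intro real_le_lsqrt) auto
        then have "1 / (5/4 / r ^ 3) \<le> 1 / sqrt (\<alpha> * \<beta>)"
          using r \<open>0 < \<alpha>\<close> \<open>0 < \<beta>\<close> by (intro divide_left_mono) auto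
        moreover have "r ^ 3 * max 1 \<bar>A\<bar> \<le> r ^ 3 * (5/4)"
          using True r by (intro mult_left_mono) auto
        ultimately show ?thesis by (simp add: A_def)
      qed
    qed (use E G Q in auto)
  next
    case False
    then have A: "5/4 \<le> \<bar>A\<bar>" by simp
    then have y1: "y$1 = r * A" "y$1 \<noteq> 0" using r by (auto simp: A_def)
    \<comment> \<open>Far from the axis X2 behaves like y1 times the x2-derivative, so the
      quasi-ball has width of order r and height of order r |y1| instead of r^2.\<close>
    define \<alpha> \<beta> where "\<alpha> = 25/16 / r\<^sup>2" and "\<beta> = 25/16 / ((y$1)\<^sup>2 * r\<^sup>2)"
    have Q: "ellipse \<alpha> \<beta> y x = 25/16 * (X x - A)\<^sup>2 + 25/16 / A\<^sup>2 * (Y x)\<^sup>2" for x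
    proof -
      have "\<alpha> * (x$1 - y$1)\<^sup>2 = 25/16 * ((x$1 - y$1) / r)\<^sup>2" by (simp add: \<alpha>_def power_divide)
      moreover have "(x$1 - y$1) / r = X x - A" by (simp add: A_def X_def diff_divide_distrib)
      moreover have "\<beta> * (x$2 - y$2)\<^sup>2 = 25/16 / A\<^sup>2 * (Y x)\<^sup>2"
        using r A by (simp add: \<beta>_def A_def Y_def power_divide power2_eq_square)
      ultimately show ?thesis by (simp add: ellipse_def)
    qed
    have "(5/4)\<^sup>2 \<le> A\<^sup>2" using A by (intro abs_le_square_iff[THEN iffD1]) auto
    then have A2: "25/16 \<le> A\<^sup>2" by (simp add: power_divide)
    have \<alpha>\<beta>: "\<alpha> = \<beta> * (y$1)\<^sup>2" "\<alpha> * (y$1)\<^sup>2 = 25/16 * A\<^sup>2"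
      using r y1(2) by (simp_all add: \<alpha>_def \<beta>_def A_def power_divide)
    note E = far_from_axis_ellipse[OF A]
    show thesis
    proof (rule that[of \<alpha> \<beta> y])
      show "0 < \<alpha>" "0 < \<beta>" using r y1(2) by (auto simp: \<alpha>_def \<beta>_def)
      then show "1/1000 \<le> \<alpha> * (y$1)\<^sup>2" "\<alpha> / 200 \<le> \<beta> * (y$1)\<^sup>2"
        using A2 \<alpha>\<beta> by auto
      show "\<beta> * (x$1)\<^sup>2 \<le> 6 * \<alpha>" if "ellipse \<alpha> \<beta> y x \<le> 1" for x
      proof -
        have "(X x)\<^sup>2 \<le> 6 * A\<^sup>2" using E(2) that Q by simp
        then have "(x$1)\<^sup>2 \<le> 6 * (y$1)\<^sup>2"
          using r by (simp add: X_def A_def power_divide divide_le_cancel)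
        then have "\<beta> * (x$1)\<^sup>2 \<le> \<beta> * (6 * (y$1)\<^sup>2)" using \<open>0 < \<beta>\<close> by (intro mult_left_mono) auto
        then show ?thesis by (simp add: \<alpha>\<beta>(1))
      qed
      show "16/25 * (r ^ 3 * max 1 \<bar>y$1 / r\<bar>) \<le> 1 / sqrt (\<alpha> * \<beta>)"
      proof -
        have "\<alpha> * \<beta> = (25/16 / (r ^ 3 * \<bar>A\<bar>))\<^sup>2"
          using r by (simp add: \<alpha>_def \<beta>_def y1 power_divide power_mult_distrib power2_eq_square power3_eq_cube)
        then have "sqrt (\<alpha> * \<beta>) = 25/16 / (r ^ 3 * \<bar>A\<bar>)"
          using r by simp
        moreover have "max 1 \<bar>A\<bar> = \<bar>A\<bar>" using A by simp
        ultimately show ?thesis by (simp add: A_def)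
      qed
    qed (use E G Q in auto)
  qed
qed

theorem theorem5p2:
  fixes lam Lam :: real
  assumes "0 < lam" and "lam \<le> Lam"
  shows "\<exists>\<nu> M :: real. 0 < \<nu> \<and> \<nu> < 1 \<and> 1 < M \<and>
    (\<forall>(a11 :: real^2 \<Rightarrow> real) (a12 :: real^2 \<Rightarrow> real) (a22 :: real^2 \<Rightarrow> real).
       a11 \<in> borel_measurable lebesgue \<longrightarrow>
       a12 \<in> borel_measurable lebesgue \<longrightarrow>
       a22 \<in> borel_measurable lebesgue \<longrightarrow>
       ellipticity_constants lam Lam a11 a12 a22 \<longrightarrow>
       (\<forall>(y :: real^2) (r :: real) (u :: real^2 \<Rightarrow> real).
          0 < r \<longrightarrow>
          Ck_on 2 u (G y (2 * r)) \<longrightarrow>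
          continuous_on (closure (G y (2 * r))) u \<longrightarrow>
          (\<forall>x\<in>closure (G y (2 * r)). 0 \<le> u x) \<longrightarrow>
          (\<forall>x\<in>G y (2 * r). grushin_op a11 a12 a22 u x \<le> 0) \<longrightarrow>
          (INF x\<in>G y r. u x) \<le> 1 \<longrightarrow>
          measure lebesgue ({x. u x \<le> M} \<inter> G y (3 * r / 2))
            \<ge> \<nu> * measure lebesgue (G y (3 * r / 2))))"
proof -
  obtain \<nu>0 M :: real where M: "0 < \<nu>0" "1 < M"
    and core: "\<And>a11 a12 a22 \<alpha> \<beta> c u U x0. ellipticity_constants lam Lam a11 a12 a22 \<Longrightarrow> 0 < \<alpha> \<Longrightarrow> 0 < \<beta> \<Longrightarrow>
      1/1000 \<le> \<alpha> * (c$1)\<^sup>2 \<Longrightarrow> \<alpha> / 200 \<le> \<beta> * (c$1)\<^sup>2 \<Longrightarrow>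
      (\<And>x. ellipse \<alpha> \<beta> c x \<le> 1 \<Longrightarrow> \<beta> * (x$1)\<^sup>2 \<le> 6 * \<alpha>) \<Longrightarrow>
      open U \<Longrightarrow> {x. ellipse \<alpha> \<beta> c x \<le> 1} \<subseteq> U \<Longrightarrow> Ck_on 2 u U \<Longrightarrow> (\<And>x. x \<in> U \<Longrightarrow> 0 \<le> u x) \<Longrightarrow>
      (\<And>x. x \<in> U \<Longrightarrow> grushin_op a11 a12 a22 u x \<le> 0) \<Longrightarrow>
      ellipse \<alpha> \<beta> c x0 \<le> 9/10 \<Longrightarrow> u x0 \<le> 3/2 \<Longrightarrow>
      \<nu>0 / sqrt (\<alpha> * \<beta>) \<le> measure lebesgue {x. ellipse \<alpha> \<beta> c x < 1/2000 \<and> u x \<le> M}"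
    using sublevel_measure_in_ellipse[OF assms] by blast
  \<comment> \<open>18 is the factor in the volume bound of the quasi-ball, 16/25 that in the area
    bound of the ellipse; the minimum with 1/2 secures \<nu> < 1.\<close>
  define \<nu> where "\<nu> = min (1/2) (\<nu>0 * (16/25) / 18)"
  have main: "measure lebesgue ({x. u x \<le> M} \<inter> G y (3 * r / 2)) \<ge> \<nu> * measure lebesgue (G y (3 * r / 2))"
    if ell: "ellipticity_constants lam Lam a11 a12 a22" and r: "0 < r" and u: "Ck_on 2 u (G y (2 * r))"
      and nonneg: "\<And>x. x \<in> closure (G y (2 * r)) \<Longrightarrow> 0 \<le> u x"
      and super: "\<And>x. x \<in> G y (2 * r) \<Longrightarrow> grushin_op a11 a12 a22 u x \<le> 0"
      and inf: "(INF x\<in>G y r. u x) \<le> 1"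
    for a11 a12 a22 u :: "real^2 \<Rightarrow> real" and y :: "real^2" and r
  proof -
    let ?U = "G y (2 * r)" and ?G = "G y (3 / 2 * r)"
    have "open ?U" using r by (intro open_G) auto
    have nonneg': "0 \<le> u x" if "x \<in> ?U" for x
      using nonneg closure_subset that by blast
    have "G y r \<subseteq> ?U" using G_mono[OF r, of 1 2 y] by simp
    have "?G \<subseteq> ?U" using r by (intro G_mono) auto
    \<comment> \<open>A real infimum is informative only over a nonempty set on which the function
      is bounded below.\<close>
    have "y \<in> G y r" using r by (auto simp: G_def g_def rho_def)
    moreover have "bdd_below (u ` G y r)"
      using nonneg' \<open>G y r \<subseteq> ?U\<close> by (intro bdd_belowI[of _ 0]) auto
    \<comment> \<open>The infimum need not be attained; 3/2 in place of 1 yields a point, and the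
      barrier height 2 absorbs the difference.\<close>
    moreover have "(INF x\<in>G y r. u x) < 3/2" using inf by simp
    ultimately obtain x0 where x0: "x0 \<in> G y r" "u x0 < 3/2"
      by (subst (asm) cINF_less_iff) auto
    obtain \<alpha> \<beta> and c :: "real^2" where e: "0 < \<alpha>" "0 < \<beta>" "1/1000 \<le> \<alpha> * (c$1)\<^sup>2" "\<alpha> / 200 \<le> \<beta> * (c$1)\<^sup>2"
      "\<And>x. ellipse \<alpha> \<beta> c x \<le> 1 \<Longrightarrow> \<beta> * (x$1)\<^sup>2 \<le> 6 * \<alpha>"
      and inner: "\<And>x. x \<in> G y r \<Longrightarrow> ellipse \<alpha> \<beta> c x \<le> 9/10"
      and outer: "{x. ellipse \<alpha> \<beta> c x \<le> 1} \<subseteq> ?U"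
      and core_sub: "{x. ellipse \<alpha> \<beta> c x < 1/2000} \<subseteq> ?G"
      and area: "16/25 * (r ^ 3 * max 1 \<bar>y$1 / r\<bar>) \<le> 1 / sqrt (\<alpha> * \<beta>)"
      using ellipse_between_G[OF r, of y] by blast
    have "continuous_on ?U u" using u by (simp add: numeral_2_eq_2)
    have "\<nu> * measure lebesgue ?G \<le> (\<nu>0 * (16/25) / 18) * (18 * (r ^ 3 * max 1 \<bar>y$1 / r\<bar>))"
      using M(1) measure_G_le(1)[OF r, of y] by (intro mult_mono) (auto simp: \<nu>_def)
    also have "\<dots> = \<nu>0 * (16/25 * (r ^ 3 * max 1 \<bar>y$1 / r\<bar>))" by simp
    also have "\<dots> \<le> \<nu>0 * (1 / sqrt (\<alpha> * \<beta>))"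
      using M(1) area by (intro mult_left_mono) auto
    also have "\<dots> \<le> measure lebesgue {x. ellipse \<alpha> \<beta> c x < 1/2000 \<and> u x \<le> M}"
      using core[OF ell e \<open>open ?U\<close> outer u nonneg' super inner[OF x0(1)]] x0(2) by simp
    also have "\<dots> \<le> measure lebesgue ({x. u x \<le> M} \<inter> ?G)"
    proof (rule measure_mono_fmeasurable)
      have pre: "B \<inter> ?U \<inter> u -` {..M} \<in> lmeasurable" if "B \<in> lmeasurable" for B
        using that \<open>open ?U\<close> \<open>continuous_on ?U u\<close> by (rule fmeasurable_Int_vimage_closed) simp
      have "{x. u x \<le> M} \<inter> ?G = ?G \<inter> ?U \<inter> u -` {..M}"
        using \<open>?G \<subseteq> ?U\<close> by auto
      then show "{x. u x \<le> M} \<inter> ?G \<in> lmeasurable"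
        using pre[OF measure_G_le(2)[OF r]] by simp
      have "{x. ellipse \<alpha> \<beta> c x < 1/2000 \<and> u x \<le> M} = {x. ellipse \<alpha> \<beta> c x < 1/2000} \<inter> ?U \<inter> u -` {..M}"
        using core_sub \<open>?G \<subseteq> ?U\<close> by auto
      moreover have "{x. ellipse \<alpha> \<beta> c x < 1/2000} \<in> lmeasurable"
        using e(1,2) by (rule fmeasurable_ellipse)
      ultimately show "{x. ellipse \<alpha> \<beta> c x < 1/2000 \<and> u x \<le> M} \<in> sets lebesgue"
        using pre by (simp add: fmeasurableD)
      show "{x. ellipse \<alpha> \<beta> c x < 1/2000 \<and> u x \<le> M} \<subseteq> {x. u x \<le> M} \<inter> ?G"
        using core_sub by auto
    qed
    finally show ?thesis by (simp add: mult.commute)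
  qed
  have "0 < \<nu>" "\<nu> < 1" using M(1) by (auto simp: \<nu>_def)
  with M(2) main show ?thesis by blast
qed

end
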